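(* Let $X$ be a nonempty compact metric space and let $f\colon X\to X$ be a continuous map with the shadowing property. Then the following properties are equivalent: \begin{itemize} \item[(1)] $f$ has the property S and is chain proximal; \item[(2)] $f$ is chain proximal, and the unique chain stable chain component $C$ for $f$ contains a distal pair for $f|_C$ (i.e. there is $(x,y)\in C^2$ with $\inf_{i\ge0}d(f^i(x),f^i(y))>0$); \item[(3)] $f$ exhibits $gu{\rm DC1}$; \item[(4)] $f$ exhibits $du{\rm DC1}$; \item[(5)] $f$ exhibits $g{\rm DC1}$. \end{itemize}
   Context: $d$ denotes the metric of $X$, and $f\colon X\to X$ is continuous. Chains and shadowing. For $\delta>0$, a $\delta$-chain of $f$ is a finite sequence $(x_i)_{i=0}^k$ in $X$, with $k$ a positive integer, such that $d(f(x_i),x_{i+1})\le\delta$ for every $0\le i\le k-1$. A $\delta$-pseudo orbit of $f$ is an infinite sequence $(x_i)_{i\ge0}$ in $X$ with $d(f(x_i),x_{i+1})\le\delta$ for all $i\ge0$. A sequence $(x_i)_{i\ge0}$ is $\epsilon$-shadowed by $x\in X$ if $d(f^i(x),x_i)\le\epsilon$ for all $i\ge0$. The map $f$ has the shadowing property if for every $\epsilon>0$ there is $\delta>0$ such that every $\delta$-pseudo orbit of $f$ is $\epsilon$-shadowed by some $x\in X$. Distributional chaos. For $(x,y)\in X^2$ and $t>0$ let \[ F_{xy}(t)=\liminf_{n\to\infty}\frac1n|\{0\le i\le n-1\colon d(f^i(x),f^i(y))<t\}|,\qquad F^\ast_{xy}(t)=\limsup_{n\to\infty}\frac1n|\{0\le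 i\le n-1\colon d(f^i(x),f^i(y))<t\}|. \] For $\delta>0$, ${\rm DC1}_\delta(X,f)$ is the set of $(x,y)\in X^2$ with $F_{xy}(\delta)=0$ and $F^\ast_{xy}(t)=1$ for all $t>0$; put ${\rm DC1}(X,f)=\bigcup_{\delta>0}{\rm DC1}_\delta(X,f)$. The map $f$ exhibits $gu{\rm DC1}$ if ${\rm DC1}_\delta(X,f)$ is a residual subset of $X^2$ for some $\delta>0$; $du{\rm DC1}$ if ${\rm DC1}_\delta(X,f)$ is a dense subset of $X^2$ for some $\delta>0$; $g{\rm DC1}$ if ${\rm DC1}(X,f)$ is a residual subset of $X^2$. Property S. $f$ satisfies the property S if there is $e>0$ such that for any $(x,y)\in X^2$ and $\delta>0$ there exists a pair $((x_i)_{i=0}^\infty,(y_i)_{i=0}^\infty)$ of $\delta$-pseudo orbits of $f$ with $(x_0,y_0)=(x,y)$ and $\liminf_{i\to\infty}d(x_i,y_i)>e$. Chain proximality. $f$ is chain proximal if for every $(x,y)\in X^2$ and every $\delta>0$ there is a pair $((x_i)_{i=0}^k,(y_i)_{i=0}^k)$ of $\delta$-chains of $f$ with $(x_0,y_0)=(x,y)$ and $x_k=y_k$. Chain components. A point $x\in X$ is chain recurrent for $f$ if for every $\delta>0$ there is a $\delta$-chain $(x_i)_{i=0}^k$ of $f$ with $x_0=x_k=x$; $CR(f)$ is the set of chain recurrent points. For $x,y\in X$ write $x\rightarrow y$ if for every $\delta>0$ there is a $\delta$-chain $(x_i)_{i=0}^k$ of $f$ with $x_0=x$ and $x_k=y$.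 The relation on $CR(f)$ given by $x\leftrightarrow y$ iff $x\rightarrow y$ and $y\rightarrow x$ is an equivalence relation; its equivalence classes are the chain components for $f$. Each is a closed subset $C$ with $f(C)\subset C$. Chain stability. A closed set $S\subset X$ with $f(S)\subset S$ is chain stable if for every $\epsilon>0$ there is $\delta>0$ such that every $\delta$-chain $(x_i)_{i=0}^k$ of $f$ with $x_0\in S$ satisfies $d(x_i,S)\le\epsilon$ for all $0\le i\le k$, where $d(x,S)=\inf_{s\in S}d(x,s)$. A chain proximal map has exactly one chain stable chain component; "the unique chain stable chain component" in (2) refers to it. *)

theory Defs
  imports "HOL-Analysis.Analysis"
begin

text \<open>
  The space \<open>X\<close> is a subset of a type of class \<open>metric_space\<close>, with the induced metric and
  topology. The map \<open>f\<close> is a total function on that type of which only the values on \<open>X\<close> matter.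
  Finite sequences \<open>x\<^sub>0, \<dots>, x\<^sub>k\<close> are functions on \<open>nat\<close> whose values beyond \<open>k\<close> are ignored.
\<close>

definition delta_chain ::
  "'a::metric_space set \<Rightarrow> ('a \<Rightarrow> 'a) \<Rightarrow> real \<Rightarrow> nat \<Rightarrow> (nat \<Rightarrow> 'a) \<Rightarrow> bool" where
  "delta_chain X f \<delta> k x \<longleftrightarrow>
     k > 0 \<and> (\<forall>i\<le>k. x i \<in> X) \<and> (\<forall>i<k. dist (f (x i)) (x (Suc i)) \<le> \<delta>)"

definition pseudo_orbit ::
  "'a::metric_space set \<Rightarrow> ('a \<Rightarrow> 'a) \<Rightarrow> real \<Rightarrow> (nat \<Rightarrow> 'a) \<Rightarrow> bool" where
  "pseudo_orbit X f \<delta> x \<longleftrightarrow>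
     (\<forall>i. x i \<in> X) \<and> (\<forall>i. dist (f (x i)) (x (Suc i)) \<le> \<delta>)"

definition shadowed_by ::
  "('a::metric_space \<Rightarrow> 'a) \<Rightarrow> real \<Rightarrow> (nat \<Rightarrow> 'a) \<Rightarrow> 'a \<Rightarrow> bool" where
  "shadowed_by f \<epsilon> x z \<longleftrightarrow> (\<forall>i. dist ((f ^^ i) z) (x i) \<le> \<epsilon>)"

definition shadowing_property :: "'a::metric_space set \<Rightarrow> ('a \<Rightarrow> 'a) \<Rightarrow> bool" where
  "shadowing_property X f \<longleftrightarrow>
     (\<forall>\<epsilon>>0. \<exists>\<delta>>0. \<forall>x. pseudo_orbit X f \<delta> x \<longrightarrow> (\<exists>z\<in>X. shadowed_by f \<epsilon> x z))"

text \<open>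
  The limits are taken in \<open>ereal\<close>, since \<open>liminf\<close> and \<open>limsup\<close> are defined on complete lattices.
\<close>

definition close_frequency ::
  "('a::metric_space \<Rightarrow> 'a) \<Rightarrow> 'a \<Rightarrow> 'a \<Rightarrow> real \<Rightarrow> nat \<Rightarrow> real" where
  "close_frequency f x y t n =
     real (card {i. i < n \<and> dist ((f ^^ i) x) ((f ^^ i) y) < t}) / real n"

definition lower_distribution ::
  "('a::metric_space \<Rightarrow> 'a) \<Rightarrow> 'a \<Rightarrow> 'a \<Rightarrow> real \<Rightarrow> ereal" where
  "lower_distribution f x y t = liminf (\<lambda>n. ereal (close_frequency f x y t n))"

definition upper_distribution ::
  "('a::metric_space \<Rightarrow> 'a) \<Rightarrow> 'a \<Rightarrow> 'a \<Rightarrow> real \<Rightarrow> ereal" where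
  "upper_distribution f x y t = limsup (\<lambda>n. ereal (close_frequency f x y t n))"

definition DC1_delta ::
  "'a::metric_space set \<Rightarrow> ('a \<Rightarrow> 'a) \<Rightarrow> real \<Rightarrow> ('a \<times> 'a) set" where
  "DC1_delta X f \<delta> =
     {(x, y). x \<in> X \<and> y \<in> X \<and> lower_distribution f x y \<delta> = 0 \<and>
              (\<forall>t>0. upper_distribution f x y t = 1)}"

definition DC1 :: "'a::metric_space set \<Rightarrow> ('a \<Rightarrow> 'a) \<Rightarrow> ('a \<times> 'a) set" where
  "DC1 X f = (\<Union>\<delta>\<in>{0<..}. DC1_delta X f \<delta>)"

definition dense_in :: "'b topology \<Rightarrow> 'b set \<Rightarrow> bool" where
  "dense_in T S \<longleftrightarrow> S \<subseteq> topspace T \<and> T closure_of S = topspace T"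

definition residual_in :: "'b topology \<Rightarrow> 'b set \<Rightarrow> bool" where
  "residual_in T S \<longleftrightarrow> S \<subseteq> topspace T \<and>
     (\<exists>\<U>. countable \<U> \<and> (\<forall>U\<in>\<U>. openin T U \<and> dense_in T U) \<and> topspace T \<inter> \<Inter>\<U> \<subseteq> S)"

definition guDC1 :: "'a::metric_space set \<Rightarrow> ('a \<Rightarrow> 'a) \<Rightarrow> bool" where
  "guDC1 X f \<longleftrightarrow> (\<exists>\<delta>>0. residual_in (top_of_set (X \<times> X)) (DC1_delta X f \<delta>))"

definition duDC1 :: "'a::metric_space set \<Rightarrow> ('a \<Rightarrow> 'a) \<Rightarrow> bool" where
  "duDC1 X f \<longleftrightarrow> (\<exists>\<delta>>0. dense_in (top_of_set (X \<times> X)) (DC1_delta X f \<delta>))"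

definition gDC1 :: "'a::metric_space set \<Rightarrow> ('a \<Rightarrow> 'a) \<Rightarrow> bool" where
  "gDC1 X f \<longleftrightarrow> residual_in (top_of_set (X \<times> X)) (DC1 X f)"

definition property_S :: "'a::metric_space set \<Rightarrow> ('a \<Rightarrow> 'a) \<Rightarrow> bool" where
  "property_S X f \<longleftrightarrow>
     (\<exists>e>0. \<forall>x\<in>X. \<forall>y\<in>X. \<forall>\<delta>>0. \<exists>xs ys.
        pseudo_orbit X f \<delta> xs \<and> pseudo_orbit X f \<delta> ys \<and> xs 0 = x \<and> ys 0 = y \<and>
        liminf (\<lambda>i. ereal (dist (xs i) (ys i))) > ereal e)"

definition chain_proximal :: "'a::metric_space set \<Rightarrow> ('a \<Rightarrow> 'a) \<Rightarrow> bool" where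
  "chain_proximal X f \<longleftrightarrow>
     (\<forall>x\<in>X. \<forall>y\<in>X. \<forall>\<delta>>0. \<exists>k xs ys.
        delta_chain X f \<delta> k xs \<and> delta_chain X f \<delta> k ys \<and>
        xs 0 = x \<and> ys 0 = y \<and> xs k = ys k)"

definition chain_leads :: "'a::metric_space set \<Rightarrow> ('a \<Rightarrow> 'a) \<Rightarrow> 'a \<Rightarrow> 'a \<Rightarrow> bool" where
  "chain_leads X f x y \<longleftrightarrow>
     (\<forall>\<delta>>0. \<exists>k xs. delta_chain X f \<delta> k xs \<and> xs 0 = x \<and> xs k = y)"

definition chain_recurrent_set :: "'a::metric_space set \<Rightarrow> ('a \<Rightarrow> 'a) \<Rightarrow> 'a set" where
  "chain_recurrent_set X f = {x \<in> X. chain_leads X f x x}"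

definition chain_equivalence :: "'a::metric_space set \<Rightarrow> ('a \<Rightarrow> 'a) \<Rightarrow> ('a \<times> 'a) set" where
  "chain_equivalence X f =
     {(x, y). x \<in> chain_recurrent_set X f \<and> y \<in> chain_recurrent_set X f \<and>
              chain_leads X f x y \<and> chain_leads X f y x}"

definition chain_components :: "'a::metric_space set \<Rightarrow> ('a \<Rightarrow> 'a) \<Rightarrow> 'a set set" where
  "chain_components X f = chain_recurrent_set X f // chain_equivalence X f"

definition chain_stable :: "'a::metric_space set \<Rightarrow> ('a \<Rightarrow> 'a) \<Rightarrow> 'a set \<Rightarrow> bool" where
  "chain_stable X f S \<longleftrightarrow>
     closedin (top_of_set X) S \<and> f ` S \<subseteq> S \<and>
     (\<forall>\<epsilon>>0. \<exists>\<delta>>0. \<forall>k x. delta_chain X f \<delta> k x \<and> x 0 \<in> S \<longrightarrow>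
        (\<forall>i\<le>k. infdist (x i) S \<le> \<epsilon>))"

definition distal_pair :: "('a::metric_space \<Rightarrow> 'a) \<Rightarrow> 'a \<Rightarrow> 'a \<Rightarrow> bool" where
  "distal_pair f x y \<longleftrightarrow> (INF i. dist ((f ^^ i) x) ((f ^^ i) y)) > 0"

end

theory Submission
  imports Defs
begin

text \<open>
  Distributional chaos of a pair is a statement about sets of times: the times at which the two
  orbits are closer than \<open>t\<close>, respectively at least \<open>\<delta>\<close> apart, must fill proportions arbitrarily near
  1 of suitable long initial segments (\<open>DC1_delta_iff\<close>). Two features of such sets matter. With
  strict inequalities for the distances, the condition is a countable intersection of open conditions
  on the pair (\<open>openin_crowded\<close>), and it produces arbitrarily long uninterrupted runs of times
  (\<open>crowded_imp_run\<close>).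

  Under property S and chain proximality each of these open conditions is dense. Shadowing pseudo
  orbits that eventually coincide (chain proximality) gives pairs near any given pair whose orbits are
  eventually close, and shadowing pseudo orbits that eventually stay apart (property S) gives pairs
  whose orbits eventually stay apart. This yields \<open>guDC1\<close>, which implies \<open>gDC1\<close> and, by the Baire
  category theorem, \<open>duDC1\<close>.

  Back from chaos, a dense set of DC1 pairs makes the map chain proximal, since two nearby orbit points
  can be joined by one small jump. Moreover, the long runs of times at which the orbits of a DC1
  pair are at least \<open>\<delta>\<close> apart have a limit: a pair \<open>(p, q)\<close> that stays at least \<open>\<delta>\<close> apart forever
  (\<open>distal_limit_pair\<close>). If a single \<open>\<delta>\<close> works on a dense set, as in \<open>duDC1\<close>, then every pair can be
  brought by small jumps onto the orbits of such a pair, which is property S.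

  In \<open>gDC1\<close> there is no common \<open>\<delta>\<close>, and the chain stable component serves to use one distal pair for
  all starting points. For a chain proximal map it is the set \<open>chain_core\<close> of all points to which every
  point leads: this set is nonempty by compactness, it is chain stable, and any other chain stable
  component would meet it (\<open>chain_stable_components\<close>). Chain proximality of \<open>z\<close> and \<open>f z\<close> gives loops
  at \<open>z\<close> of two consecutive lengths, so that points of the core are reached by chains of every large
  length (\<open>chain_mixing_into_core\<close>). Hence any two points reach the two members of a distal pair of
  the core simultaneously, and a distal pair in the core implies property S. Conversely, under property
  S such a pair is a limit of pairs of pseudo orbits that start in the core and stay apart. Finally,
  the orbits of a generic pair accumulate at a given point of the core, so that all their limit
  points lie in the core; applied to a generic DC1 pair this places \<open>(p, q)\<close> in the core.
\<close>

section \<open>Sets of natural numbers that fill most of a long initial segment\<close>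

text \<open>The inequality says \<open>n / (n + 1) < card (A \<inter> {..<N}) / N\<close>. Holding for all \<open>n\<close>, it says that \<open>A\<close>
  has upper density 1; for a single \<open>n\<close> it is witnessed by finitely many elements of \<open>A\<close>.\<close>

definition crowded :: "nat \<Rightarrow> nat set \<Rightarrow> bool" where
  "crowded n A \<longleftrightarrow> (\<exists>N>n. n * N < (n + 1) * card (A \<inter> {..<N}))"

lemma crowded_finite_witness:
  assumes "crowded n A"
  shows "\<exists>B. finite B \<and> B \<subseteq> A \<and> (\<forall>A'. B \<subseteq> A' \<longrightarrow> crowded n A')"
proof -
  obtain N where N: "N > n" "n * N < (n + 1) * card (A \<inter> {..<N})"
    using assms unfolding crowded_def by blast
  have "crowded n A'" if "A \<inter> {..<N} \<subseteq> A'" for A'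
  proof -
    have "card (A \<inter> {..<N}) \<le> card (A' \<inter> {..<N})"
      using that by (intro card_mono) auto
    then have "(n + 1) * card (A \<inter> {..<N}) \<le> (n + 1) * card (A' \<inter> {..<N})"
      by (rule mult_le_mono2)
    with N show ?thesis
      unfolding crowded_def by (meson less_le_trans)
  qed
  then show ?thesis
    by (intro exI[of _ "A \<inter> {..<N}"]) auto
qed

lemma crowded_mono: "crowded n A \<Longrightarrow> A \<subseteq> A' \<Longrightarrow> crowded n A'"
  using crowded_finite_witness by (meson subset_trans)

lemma crowded_if_eventually:
  assumes "\<And>i. i \<ge> k \<Longrightarrow> i \<in> A"
  shows "crowded n A"
proof -
  \<comment> \<open>Large enough for the \<open>k\<close> possibly missing elements to be less than a proportion \<open>1 / (n + 1)\<close>.\<close>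
  define N where "N = (n + 1) * (k + 1)"
  have "card {k..<N} \<le> card (A \<inter> {..<N})"
    using assms by (intro card_mono) auto
  then have "(n + 1) * (N - k) \<le> (n + 1) * card (A \<inter> {..<N})"
    by (intro mult_le_mono2) simp
  moreover have "n * N < (n + 1) * (N - k)"
  proof -
    have "k \<le> N" by (simp add: N_def)
    then obtain m where m: "N = k + m" by (metis le_Suc_ex)
    have "n * N + (n + 1) * k < n * N + N" by (simp add: N_def)
    then show ?thesis by (simp add: m algebra_simps)
  qed
  moreover have "N > n" by (simp add: N_def)
  ultimately show ?thesis unfolding crowded_def by (meson less_le_trans)
qed

text \<open>If every window of length \<open>L\<close> met the complement of \<open>A\<close>, then \<open>A\<close> would miss about a
  proportion \<open>1 / L\<close> of every initial segment. The level \<open>2 * L\<close> leaves room for the incomplete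
  last window: \<open>N div L\<close> exceeds \<open>N / (2 * L)\<close> once \<open>N \<ge> L\<close>.\<close>

lemma crowded_imp_run:
  assumes "crowded (2 * L) A" and "L > 0"
  shows "\<exists>m. {m..<m + L} \<subseteq> A"
proof (rule ccontr)
  assume no_run: "\<nexists>m. {m..<m + L} \<subseteq> A"
  have gaps: "q \<le> card ({..<q * L} - A)" for q
  proof (induction q)
    case (Suc q)
    obtain i where i: "i \<in> {q * L..<q * L + L}" "i \<notin> A"
      using no_run by blast
    have "Suc (card ({..<q * L} - A)) = card (insert i ({..<q * L} - A))"
      using i by simp
    also have "\<dots> \<le> card ({..<Suc q * L} - A)"
      using i by (intro card_mono) auto
    finally show ?case using Suc by simp
  qed simp
  obtain N where N: "N > 2 * L" "2 * L * N < (2 * L + 1) * card (A \<inter> {..<N})"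
    using assms(1) unfolding crowded_def by blast
  define q where "q = N div L"
  have q: "q * L \<le> N" "N < q * L + L"
    using div_mult_mod_eq[of N L] mod_less_divisor[OF \<open>L > 0\<close>, of N] unfolding q_def by linarith+
  have "card (A \<inter> {..<N}) + q \<le> card (A \<inter> {..<N}) + card ({..<N} - A)"
    using gaps[of q] card_mono[of "{..<N} - A" "{..<q * L} - A"] q(1) by fastforce
  also have "\<dots> = N"
    using card_Int_Diff[of "{..<N}" A] by (simp add: Int_commute)
  finally have "(2 * L + 1) * (card (A \<inter> {..<N}) + q) \<le> (2 * L + 1) * N"
    by (rule mult_le_mono2)
  then have "2 * L * N + (2 * L + 1) * q < (2 * L + 1) * N"
    using N(2) by (simp add: algebra_simps)
  then have "2 * (q * L) < N" by (simp add: algebra_simps)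
  moreover have "L \<le> q * L"
    using q(2) N(1) by (cases q) auto
  ultimately show False using q(2) by linarith
qed

text \<open>Only the bound from below has content, and it suffices to test it on the thresholds
  \<open>n / (n + 1)\<close>, which tend to 1.\<close>

lemma limsup_eq_1_iff:
  fixes u :: "nat \<Rightarrow> real"
  assumes "\<And>N. u N \<le> 1"
  shows "limsup (\<lambda>N. ereal (u N)) = 1 \<longleftrightarrow> (\<forall>n. \<exists>N>n. real n / (real n + 1) < u N)"
proof
  assume lim: "limsup (\<lambda>N. ereal (u N)) = 1"
  show "\<forall>n. \<exists>N>n. real n / (real n + 1) < u N"
  proof (rule ccontr)
    assume "\<not> (\<forall>n. \<exists>N>n. real n / (real n + 1) < u N)"
    then obtain n where n: "\<And>N. N > n \<Longrightarrow> u N \<le> real n / (real n + 1)"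
      by (meson not_less)
    then have "limsup (\<lambda>N. ereal (u N)) \<le> ereal (real n / (real n + 1))"
      by (intro Limsup_bounded) (auto simp: eventually_at_top_dense)
    then show False by (simp add: lim one_ereal_def field_simps)
  qed
next
  assume freq: "\<forall>n. \<exists>N>n. real n / (real n + 1) < u N"
  have "limsup (\<lambda>N. ereal (u N)) \<le> 1"
    using assms by (intro Limsup_bounded) (simp add: one_ereal_def)
  moreover have "\<not> limsup (\<lambda>N. ereal (u N)) < 1"
  proof
    assume "limsup (\<lambda>N. ereal (u N)) < 1"
    then obtain y where y: "limsup (\<lambda>N. ereal (u N)) < ereal y" "y < 1"
      using ereal_dense2 by (metis less_ereal.simps(1) one_ereal_def)
    then obtain M where M: "\<And>N. N \<ge> M \<Longrightarrow> u N < y"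
      using Limsup_lessD[OF y(1)] by (auto simp: eventually_at_top_linorder)
    have "(\<lambda>n. real n / (real n + 1)) \<longlonglongrightarrow> 1"
      using LIMSEQ_n_over_Suc_n by (simp add: add.commute)
    then have "\<forall>\<^sub>F n in sequentially. y < real n / (real n + 1)"
      using y(2) by (rule order_tendstoD)
    then obtain n where n: "n \<ge> M" "y < real n / (real n + 1)"
      using eventually_happens'[OF _ eventually_conj[OF _ eventually_ge_at_top[of M]]] by auto
    obtain N where "N > n" "real n / (real n + 1) < u N" using freq by blast
    with M[of N] n show False by simp
  qed
  ultimately show "limsup (\<lambda>N. ereal (u N)) = 1" by simp
qed

lemma crowded_iff_frequency:
  "crowded n A \<longleftrightarrow> (\<exists>N>n. real n / (real n + 1) < real (card (A \<inter> {..<N})) / real N)"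
proof -
  have "n * N < (n + 1) * card (A \<inter> {..<N}) \<longleftrightarrow>
      real n / (real n + 1) < real (card (A \<inter> {..<N})) / real N" if "N > n" for N
  proof -
    have "real n / (real n + 1) < real (card (A \<inter> {..<N})) / real N \<longleftrightarrow>
        real (n * N) < real ((n + 1) * card (A \<inter> {..<N}))"
      using that by (simp add: field_simps)
    then show ?thesis using of_nat_less_iff by blast
  qed
  then show ?thesis unfolding crowded_def by blast
qed

lemma close_frequency_eq:
  "close_frequency f x y t N =
     real (card ({i. dist ((f ^^ i) x) ((f ^^ i) y) < t} \<inter> {..<N})) / real N"
  unfolding close_frequency_def by (simp add: Int_def lessThan_def conj_commute)

lemma initial_frequency_le_1: "real (card (A \<inter> {..<N})) / real N \<le> 1"
  using card_mono[of "{..<N}" "A \<inter> {..<N}"] by (cases "N = 0") (simp_all add: divide_le_eq_1)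

lemma upper_distribution_eq_1_iff:
  "upper_distribution f x y t = 1 \<longleftrightarrow>
     (\<forall>n. crowded n {i. dist ((f ^^ i) x) ((f ^^ i) y) < t})"
  unfolding upper_distribution_def close_frequency_eq crowded_iff_frequency
  by (rule limsup_eq_1_iff) (rule initial_frequency_le_1)

lemma lower_distribution_eq_0_iff:
  "lower_distribution f x y t = 0 \<longleftrightarrow>
     (\<forall>n. crowded n {i. t \<le> dist ((f ^^ i) x) ((f ^^ i) y)})"
proof -
  let ?far = "{i. t \<le> dist ((f ^^ i) x) ((f ^^ i) y)}"
  let ?near = "{i. dist ((f ^^ i) x) ((f ^^ i) y) < t}"
  let ?u = "\<lambda>N. real (card (?far \<inter> {..<N})) / real N"
  have compl: "ereal (close_frequency f x y t N) = 1 - ereal (?u N)" if "N > 0" for N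
  proof -
    have "{..<N} \<inter> ?near = ?near \<inter> {..<N}" "{..<N} - ?near = ?far \<inter> {..<N}" by auto
    then have "card (?near \<inter> {..<N}) + card (?far \<inter> {..<N}) = N"
      using card_Int_Diff[of "{..<N}" ?near] by simp
    then have "real (card (?near \<inter> {..<N})) = real N - real (card (?far \<inter> {..<N}))"
      by linarith
    then show ?thesis
      using that unfolding close_frequency_eq by (simp add: one_ereal_def diff_divide_distrib)
  qed
  have "lower_distribution f x y t = liminf (\<lambda>N. 1 - ereal (?u N))"
    unfolding lower_distribution_def
    by (intro Liminf_eq) (auto simp: compl eventually_at_top_dense simp del: ereal_minus)
  also have "\<dots> = 1 - limsup (\<lambda>N. ereal (?u N))"
    by (rule liminf_ereal_cminus) (simp add: one_ereal_def)
  finally have "lower_distribution f x y t = 0 \<longleftrightarrow> limsup (\<lambda>N. ereal (?u N)) = 1"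
    by (cases "limsup (\<lambda>N. ereal (?u N))") (auto simp: one_ereal_def zero_ereal_def)
  also have "\<dots> \<longleftrightarrow> (\<forall>n. crowded n ?far)"
    unfolding crowded_iff_frequency
    by (rule limsup_eq_1_iff) (rule initial_frequency_le_1)
  finally show ?thesis .
qed

lemma DC1_delta_iff:
  "(x, y) \<in> DC1_delta X f \<delta> \<longleftrightarrow> x \<in> X \<and> y \<in> X \<and>
     (\<forall>n. crowded n {i. \<delta> \<le> dist ((f ^^ i) x) ((f ^^ i) y)}) \<and>
     (\<forall>t>0. \<forall>n. crowded n {i. dist ((f ^^ i) x) ((f ^^ i) y) < t})"
  by (simp add: DC1_delta_def upper_distribution_eq_1_iff lower_distribution_eq_0_iff)

section \<open>Chains of prescribed length\<close>

definition chain_reach ::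
  "'a::metric_space set \<Rightarrow> ('a \<Rightarrow> 'a) \<Rightarrow> real \<Rightarrow> nat \<Rightarrow> 'a \<Rightarrow> 'a \<Rightarrow> bool" where
  "chain_reach X f \<delta> k x y \<longleftrightarrow> (\<exists>xs. delta_chain X f \<delta> k xs \<and> xs 0 = x \<and> xs k = y)"

lemma chain_leads_iff: "chain_leads X f x y \<longleftrightarrow> (\<forall>\<delta>>0. \<exists>k. chain_reach X f \<delta> k x y)"
  unfolding chain_leads_def chain_reach_def by blast

lemma chain_proximal_iff:
  "chain_proximal X f \<longleftrightarrow>
     (\<forall>x\<in>X. \<forall>y\<in>X. \<forall>\<delta>>0. \<exists>k w. chain_reach X f \<delta> k x w \<and> chain_reach X f \<delta> k y w)"
proof -
  have "(\<exists>k xs ys. delta_chain X f \<delta> k xs \<and> delta_chain X f \<delta> k ys \<and>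
          xs 0 = x \<and> ys 0 = y \<and> xs k = ys k) \<longleftrightarrow>
        (\<exists>k w. chain_reach X f \<delta> k x w \<and> chain_reach X f \<delta> k y w)" for x y \<delta>
    unfolding chain_reach_def by metis
  then show ?thesis unfolding chain_proximal_def by simp
qed

lemma chain_reachD:
  assumes "chain_reach X f \<delta> k x y"
  shows "k > 0" "x \<in> X" "y \<in> X"
  using assms unfolding chain_reach_def delta_chain_def by auto

lemma chain_reach_mono: "chain_reach X f \<delta> k x y \<Longrightarrow> \<delta> \<le> \<eta> \<Longrightarrow> chain_reach X f \<eta> k x y"
proof -
  have "delta_chain X f \<eta> k xs" if "delta_chain X f \<delta> k xs" "\<delta> \<le> \<eta>" for xs
    using that unfolding delta_chain_def by force
  then show "chain_reach X f \<delta> k x y \<Longrightarrow> \<delta> \<le> \<eta> \<Longrightarrow> chain_reach X f \<eta> k x y"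
    unfolding chain_reach_def by blast
qed

lemma chain_reach_step:
  assumes "x \<in> X" "y \<in> X" "dist (f x) y \<le> \<delta>"
  shows "chain_reach X f \<delta> 1 x y"
  unfolding chain_reach_def delta_chain_def
  using assms by (intro exI[of _ "\<lambda>i. if i = 0 then x else y"]) auto

lemma chain_reach_trans:
  assumes "chain_reach X f \<delta> k x y" "chain_reach X f \<delta> l y z"
  shows "chain_reach X f \<delta> (k + l) x z"
proof -
  obtain xs ys where xs: "delta_chain X f \<delta> k xs" "xs 0 = x" "xs k = y"
    and ys: "delta_chain X f \<delta> l ys" "ys 0 = y" "ys l = z"
    using assms unfolding chain_reach_def by blast
  define zs where "zs = (\<lambda>i. if i < k then xs i else ys (i - k))"
  have "zs i \<in> X" if "i \<le> k + l" for i
    using xs(1) ys(1) that by (auto simp: zs_def delta_chain_def)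
  moreover have "dist (f (zs i)) (zs (Suc i)) \<le> \<delta>" if "i < k + l" for i
  proof -
    consider "Suc i < k" | "Suc i = k" | "k \<le> i" by linarith
    then show ?thesis
    proof cases
      case 2
      then have "zs (Suc i) = xs (Suc i)" using xs ys by (simp add: zs_def)
      with 2 show ?thesis using xs by (auto simp: zs_def delta_chain_def)
    next
      case 3
      then show ?thesis using ys(1) that by (auto simp: zs_def delta_chain_def Suc_diff_le)
    qed (use xs in \<open>auto simp: zs_def delta_chain_def\<close>)
  qed
  ultimately have "delta_chain X f \<delta> (k + l) zs"
    using xs(1) by (simp add: delta_chain_def)
  moreover have "zs 0 = x" "zs (k + l) = z"
    using xs ys by (auto simp: zs_def delta_chain_def)
  ultimately show ?thesis unfolding chain_reach_def by blast
qed

lemma chain_reach_change_start: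
  assumes "chain_reach X f \<delta> k x y" "x' \<in> X" "dist (f x') (f x) \<le> \<eta>"
  shows "chain_reach X f (\<eta> + \<delta>) k x' y"
proof -
  obtain xs where xs: "delta_chain X f \<delta> k xs" "xs 0 = x" "xs k = y"
    using assms(1) unfolding chain_reach_def by blast
  have "\<eta> \<ge> 0" using assms(3) by (meson order_trans zero_le_dist)
  have "dist (f ((xs(0 := x')) i)) ((xs(0 := x')) (Suc i)) \<le> \<eta> + \<delta>" if "i < k" for i
  proof -
    have "dist (f (xs i)) (xs (Suc i)) \<le> \<delta>" using xs(1) that by (simp add: delta_chain_def)
    then show ?thesis
      using dist_triangle[of "f x'" "xs (Suc 0)" "f x"] assms(3) xs(2) \<open>\<eta> \<ge> 0\<close>
      by (cases "i = 0") auto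
  qed
  then show ?thesis
    unfolding chain_reach_def using xs assms(2)
    by (intro exI[of _ "xs(0 := x')"]) (auto simp: delta_chain_def)
qed

lemma chain_reach_change_end:
  assumes "chain_reach X f \<delta> k x y" "y' \<in> X" "dist y y' \<le> \<eta>"
  shows "chain_reach X f (\<delta> + \<eta>) k x y'"
proof -
  obtain xs where xs: "delta_chain X f \<delta> k xs" "xs 0 = x" "xs k = y"
    using assms(1) unfolding chain_reach_def by blast
  have "\<eta> \<ge> 0" using assms(3) by (meson order_trans zero_le_dist)
  have "dist (f ((xs(k := y')) i)) ((xs(k := y')) (Suc i)) \<le> \<delta> + \<eta>" if "i < k" for i
  proof -
    have "dist (f (xs i)) (xs (Suc i)) \<le> \<delta>" using xs(1) that by (simp add: delta_chain_def)
    then show ?thesis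
      using dist_triangle[of "f (xs i)" y' y] assms(3) xs(3) \<open>\<eta> \<ge> 0\<close> that
      by (cases "Suc i = k") auto
  qed
  then show ?thesis
    unfolding chain_reach_def using xs assms(2)
    by (intro exI[of _ "xs(k := y')"]) (auto simp: delta_chain_def)
qed

lemma chain_reach_pseudo_orbit:
  assumes "pseudo_orbit X f \<delta> xs" "k > 0"
  shows "chain_reach X f \<delta> k (xs 0) (xs k)"
  using assms unfolding chain_reach_def pseudo_orbit_def delta_chain_def by blast

lemma chain_then_pseudo_orbit:
  assumes "chain_reach X f \<delta> k x p" "pseudo_orbit X f \<delta> ps" "ps 0 = p"
  shows "\<exists>zs. pseudo_orbit X f \<delta> zs \<and> zs 0 = x \<and> (\<forall>i. zs (k + i) = ps i)"
proof -
  obtain xs where xs: "delta_chain X f \<delta> k xs" "xs 0 = x" "xs k = p"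
    using assms(1) unfolding chain_reach_def by blast
  define zs where "zs = (\<lambda>i. if i < k then xs i else ps (i - k))"
  have "zs i \<in> X" for i
    using xs(1) assms(2) by (auto simp: zs_def delta_chain_def pseudo_orbit_def)
  moreover have "dist (f (zs i)) (zs (Suc i)) \<le> \<delta>" for i
  proof -
    consider "Suc i < k" | "Suc i = k" | "k \<le> i" by linarith
    then show ?thesis
    proof cases
      case 2
      then have "zs (Suc i) = xs (Suc i)" using xs assms(3) by (simp add: zs_def)
      with 2 show ?thesis using xs by (auto simp: zs_def delta_chain_def)
    next
      case 3
      then show ?thesis using assms(2) by (auto simp: zs_def pseudo_orbit_def Suc_diff_le)
    qed (use xs in \<open>auto simp: zs_def delta_chain_def\<close>)
  qed
  moreover have "zs 0 = x" "\<forall>i. zs (k + i) = ps i"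
    using xs assms(3) by (auto simp: zs_def delta_chain_def)
  ultimately show ?thesis unfolding pseudo_orbit_def by blast
qed

lemma chain_leads_trans: "chain_leads X f x y \<Longrightarrow> chain_leads X f y z \<Longrightarrow> chain_leads X f x z"
  unfolding chain_leads_iff by (meson chain_reach_trans)

text \<open>Writing \<open>m = q * l + r\<close> with \<open>r < l \<le> q\<close>, one uses \<open>r\<close> summands \<open>l + 1\<close> and \<open>q - r\<close> summands \<open>l\<close>.\<close>

lemma add_closed_contains_all_large:
  fixes S :: "nat set"
  assumes "0 \<in> S" "l \<in> S" "l + 1 \<in> S" and add: "\<And>a b. a \<in> S \<Longrightarrow> b \<in> S \<Longrightarrow> a + b \<in> S"
    and "l > 0" "m \<ge> l * l"
  shows "m \<in> S"
proof -
  have mult: "j * a \<in> S" if "a \<in> S" for a j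
    using that assms(1) by (induction j) (auto intro: add)
  define q r where "q = m div l" and "r = m mod l"
  have "r < l" using \<open>l > 0\<close> by (simp add: r_def)
  moreover have "l \<le> q" using \<open>m \<ge> l * l\<close> \<open>l > 0\<close> by (simp add: q_def less_eq_div_iff_mult_less_eq)
  ultimately obtain s where s: "q = r + s" by (metis le_Suc_ex less_imp_le order_trans)
  have "m = q * l + r" by (simp add: q_def r_def)
  then have "m = s * l + r * (l + 1)" by (simp add: s algebra_simps)
  then show ?thesis using add mult assms(2,3) by metis
qed

locale compact_system =
  fixes X :: "'a::metric_space set" and f :: "'a \<Rightarrow> 'a"
  assumes compact_X: "compact X" and f_into: "f ` X \<subseteq> X" and f_cont: "continuous_on X f"
begin

lemma f_mem: "x \<in> X \<Longrightarrow> f x \<in> X"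
  using f_into by blast

lemma iterate_mem: "x \<in> X \<Longrightarrow> (f ^^ i) x \<in> X"
  by (induction i) (auto intro: f_mem)

lemma iterate_cont: "continuous_on X (f ^^ i)"
proof (induction i)
  case (Suc i)
  have "continuous_on ((f ^^ i) ` X) f"
    using f_cont iterate_mem by (meson continuous_on_subset image_subsetI)
  with continuous_on_compose[OF Suc] show ?case by (simp add: comp_def)
qed (simp add: continuous_on_id)

lemma orbit_pseudo_orbit: "x \<in> X \<Longrightarrow> \<delta> \<ge> 0 \<Longrightarrow> pseudo_orbit X f \<delta> (\<lambda>i. (f ^^ i) x)"
  unfolding pseudo_orbit_def by (auto intro: iterate_mem)

lemma chain_reach_orbit:
  assumes "x \<in> X" "m < n"
  shows "chain_reach X f 0 (n - m) ((f ^^ m) x) ((f ^^ n) x)"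
proof -
  have "(f ^^ (n - m)) ((f ^^ m) x) = (f ^^ n) x"
    using assms(2) by (metis add.commute comp_apply funpow_add le_add_diff_inverse less_imp_le)
  then show ?thesis
    using chain_reach_pseudo_orbit[OF orbit_pseudo_orbit[OF iterate_mem[OF assms(1)], of 0 m], of "n - m"]
      assms(2) by simp
qed

lemma chain_leads_image: "x \<in> X \<Longrightarrow> chain_leads X f x (f x)"
  unfolding chain_leads_iff by (metis chain_reach_step dist_self f_mem less_imp_le)

lemma continuity_at:
  assumes "a \<in> X" "\<eta> > 0"
  shows "\<exists>d>0. \<forall>x\<in>X. dist x a < d \<longrightarrow> dist (f x) (f a) < \<eta>"
  using f_cont assms unfolding continuous_on_iff by blast

lemma pair_subsequence:
  assumes "\<And>n. a n \<in> X" "\<And>n. b n \<in> X"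
  obtains p q r where "p \<in> X" "q \<in> X" "strict_mono (r :: nat \<Rightarrow> nat)"
    "(\<lambda>n. a (r n)) \<longlonglongrightarrow> p" "(\<lambda>n. b (r n)) \<longlonglongrightarrow> q"
proof -
  have "\<forall>n. (a n, b n) \<in> X \<times> X" using assms by blast
  then obtain l r where l: "l \<in> X \<times> X" and r: "strict_mono (r :: nat \<Rightarrow> nat)"
      and lim: "((\<lambda>n. (a n, b n)) \<circ> r) \<longlonglongrightarrow> l"
    using compact_Times[OF compact_X compact_X, unfolded compact_def, rule_format,
        of "\<lambda>n. (a n, b n)"] by blast
  show thesis
    using l r tendsto_fst[OF lim] tendsto_snd[OF lim]
    by (intro that[of "fst l" "snd l" r]) (auto simp: comp_def)
qed

text \<open>Only the first and the last point of a chain have to be moved to the limit points, and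
  continuity of \<open>f\<close> at the limit of the first points bounds the error of the first jump.\<close>

lemma chain_leads_limit:
  assumes "a \<in> X" "b \<in> X"
    and reach: "\<And>\<epsilon> \<delta>. \<epsilon> > 0 \<Longrightarrow> \<delta> > 0 \<Longrightarrow>
      \<exists>x y k. dist x a < \<epsilon> \<and> dist y b < \<epsilon> \<and> chain_reach X f \<delta> k x y"
  shows "chain_leads X f a b"
  unfolding chain_leads_iff
proof (intro allI impI)
  fix \<delta> :: real assume "\<delta> > 0"
  then obtain d where d: "d > 0" "\<And>x. x \<in> X \<Longrightarrow> dist x a < d \<Longrightarrow> dist (f x) (f a) < \<delta> / 3"
    using continuity_at[OF assms(1), of "\<delta> / 3"] by auto
  obtain x y k where xy: "dist x a < min d (\<delta> / 3)" "dist y b < min d (\<delta> / 3)"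
      "chain_reach X f (\<delta> / 3) k x y"
    using reach[of "min d (\<delta> / 3)" "\<delta> / 3"] d(1) \<open>\<delta> > 0\<close> by auto
  have "dist (f a) (f x) \<le> \<delta> / 3"
    using d(2)[of x] xy chain_reachD(2)[OF xy(3)] by (simp add: dist_commute less_imp_le)
  from chain_reach_change_end[OF chain_reach_change_start[OF xy(3) assms(1) this] assms(2), of "\<delta> / 3"]
  have "chain_reach X f \<delta> k a b"
    using xy(2) by simp
  then show "\<exists>k. chain_reach X f \<delta> k a b" by auto
qed

lemma chain_leads_seq_limit:
  assumes "a \<in> X" "b \<in> X" "x \<longlonglongrightarrow> a" "y \<longlonglongrightarrow> b"
    and reach: "\<And>\<delta>. \<delta> > 0 \<Longrightarrow> \<forall>\<^sub>F n in sequentially. \<exists>k. chain_reach X f \<delta> k (x n) (y n)"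
  shows "chain_leads X f a b"
proof (rule chain_leads_limit[OF assms(1,2)])
  fix \<epsilon> \<delta> :: real assume "\<epsilon> > 0" "\<delta> > 0"
  then have "\<forall>\<^sub>F n in sequentially. dist (x n) a < \<epsilon> \<and> dist (y n) b < \<epsilon> \<and>
      (\<exists>k. chain_reach X f \<delta> k (x n) (y n))"
    using tendstoD[OF assms(3)] tendstoD[OF assms(4)] reach by (intro eventually_conj) auto
  then show "\<exists>x y k. dist x a < \<epsilon> \<and> dist y b < \<epsilon> \<and> chain_reach X f \<delta> k x y"
    using eventually_happens' sequentially_bot by blast
qed

end

section \<open>The chain stable component of a chain proximal map\<close>

context compact_system
begin

text \<open>For a chain proximal map this set turns out to be the only chain stable chain component.\<close>

definition chain_core :: "'a set" where
  "chain_core = {z \<in> X. \<forall>x\<in>X. chain_leads X f x z}"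

lemma chain_core_leads_mem:
  assumes "c \<in> chain_core" "z \<in> X" "chain_leads X f c z"
  shows "z \<in> chain_core"
  using assms unfolding chain_core_def by (auto intro: chain_leads_trans)

lemma chain_core_image: "c \<in> chain_core \<Longrightarrow> f c \<in> chain_core"
  using chain_core_leads_mem[of c "f c"] chain_leads_image[of c] f_mem[of c]
  by (simp add: chain_core_def)

lemma closed_leads_set:
  assumes "\<And>x. x \<in> Y \<Longrightarrow> x \<in> X"
  shows "closed {z \<in> X. \<forall>x\<in>Y. chain_leads X f x z}"
  unfolding closed_sequential_limits
proof (intro allI impI)
  fix z l assume z: "(\<forall>n. z n \<in> {z \<in> X. \<forall>x\<in>Y. chain_leads X f x z}) \<and> z \<longlonglongrightarrow> l"
  then have "l \<in> X"
    using compact_imp_closed[OF compact_X] unfolding closed_sequential_limits by blast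
  moreover have "chain_leads X f x l" if "x \<in> Y" for x
    using z that assms \<open>l \<in> X\<close>
    by (intro chain_leads_seq_limit[where x = "\<lambda>_. x" and y = z]) (auto simp: chain_leads_iff)
  ultimately show "l \<in> {z \<in> X. \<forall>x\<in>Y. chain_leads X f x z}" by blast
qed

lemma closed_chain_core: "closed chain_core"
  unfolding chain_core_def by (rule closed_leads_set)

text \<open>By compactness the meeting points of \<open>\<delta>\<close>-chains accumulate, as \<open>\<delta>\<close> tends to 0, at a point
  to which both starting points lead.\<close>

lemma common_target:
  assumes "chain_proximal X f" "x \<in> X" "y \<in> X"
  shows "\<exists>w\<in>X. chain_leads X f x w \<and> chain_leads X f y w"
proof -
  have "\<forall>n. \<exists>w. (\<exists>k. chain_reach X f (1 / real (Suc n)) k x w) \<and>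
      (\<exists>k. chain_reach X f (1 / real (Suc n)) k y w)"
    using assms unfolding chain_proximal_iff by (metis divide_pos_pos of_nat_0_less_iff zero_less_Suc zero_less_one)
  then obtain w where w: "\<And>n. \<exists>k. chain_reach X f (1 / real (Suc n)) k x (w n)"
      "\<And>n. \<exists>k. chain_reach X f (1 / real (Suc n)) k y (w n)"
    by metis
  have "\<forall>n. w n \<in> X" using w(1) chain_reachD(3) by blast
  then obtain l r where l: "l \<in> X" and r: "strict_mono r" and lim: "(w \<circ> r) \<longlonglongrightarrow> l"
    using compact_X unfolding compact_def by blast
  have "chain_leads X f u l"
    if u: "u \<in> X" "\<And>n. \<exists>k. chain_reach X f (1 / real (Suc n)) k u (w n)" for u
  proof (rule chain_leads_seq_limit[OF u(1) l tendsto_const lim])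
    fix \<delta> :: real assume "\<delta> > 0"
    have "(\<lambda>n. 1 / real (Suc (r n))) \<longlonglongrightarrow> 0"
      using LIMSEQ_subseq_LIMSEQ[OF LIMSEQ_inverse_real_of_nat r] by (simp add: comp_def inverse_eq_divide)
    then have "\<forall>\<^sub>F n in sequentially. 1 / real (Suc (r n)) < \<delta>"
      using \<open>\<delta> > 0\<close> by (rule order_tendstoD)
    then show "\<forall>\<^sub>F n in sequentially. \<exists>k. chain_reach X f \<delta> k u ((w \<circ> r) n)"
      by eventually_elim (use u(2) chain_reach_mono less_imp_le in \<open>metis comp_apply\<close>)
  qed
  with l w assms show ?thesis by blast
qed

lemma chain_core_nonempty:
  assumes "chain_proximal X f" "X \<noteq> {}"
  shows "chain_core \<noteq> {}"
proof -
  define R where "R x = {z \<in> X. chain_leads X f x z}" for x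
  have finite_target: "\<exists>w\<in>X. \<forall>x\<in>F. chain_leads X f x w" if "finite F" "F \<subseteq> X" for F
    using that
  proof (induction F)
    case (insert x F)
    then obtain w where "w \<in> X" "\<forall>x\<in>F. chain_leads X f x w" by auto
    with common_target[OF assms(1), of x w] insert.prems show ?case
      by (auto intro: chain_leads_trans)
  qed (use assms(2) in auto)
  have "X \<inter> \<Inter>(R ` X) \<noteq> {}"
  proof (rule compact_imp_fip[OF compact_X])
    show "closed T" if "T \<in> R ` X" for T
      using that closed_leads_set[of "{x}" for x] by (auto simp: R_def)
    fix \<F> assume "finite \<F>" "\<F> \<subseteq> R ` X"
    then obtain F where "finite F" "F \<subseteq> X" "\<F> = R ` F" by (meson finite_subset_image)
    with finite_target[of F] show "X \<inter> \<Inter>\<F> \<noteq> {}" by (auto simp: R_def)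
  qed
  then show ?thesis by (auto simp: chain_core_def R_def)
qed

text \<open>A point of the core leads to no point outside the core, so the core is a full equivalence class.\<close>

lemma chain_core_mem_component:
  assumes "C \<in> chain_components X f" "z \<in> C" "z \<in> chain_core"
  shows "C = chain_core"
proof -
  obtain y where y: "C = chain_equivalence X f `` {y}" "y \<in> chain_recurrent_set X f"
    using assms(1) unfolding chain_components_def by (auto elim: quotientE)
  have "chain_leads X f y z" "chain_leads X f z y" "y \<in> X"
    using assms(2) y by (auto simp: chain_equivalence_def chain_recurrent_set_def)
  then have "y \<in> chain_core"
    using assms(3) chain_core_leads_mem by blast
  then have "w \<in> C \<longleftrightarrow> w \<in> chain_core" for w
    using y chain_core_leads_mem[of y w]
    by (auto simp: chain_equivalence_def chain_recurrent_set_def chain_core_def)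
  then show ?thesis by blast
qed

lemma chain_core_component:
  assumes "chain_core \<noteq> {}"
  shows "chain_core \<in> chain_components X f"
proof -
  obtain c where c: "c \<in> chain_core" using assms by blast
  let ?C = "chain_equivalence X f `` {c}"
  have "c \<in> chain_recurrent_set X f" "c \<in> ?C"
    using c by (auto simp: chain_core_def chain_recurrent_set_def chain_equivalence_def)
  then have "?C \<in> chain_components X f"
    unfolding chain_components_def by (auto intro: quotientI)
  with chain_core_mem_component[of ?C c] c \<open>c \<in> ?C\<close> show ?thesis by simp
qed

text \<open>Otherwise \<open>\<delta>\<close>-chains with \<open>\<delta>\<close> tending to 0 would lead from the core to points staying away
  from it; at a limit of these points the core would be left by true chain reachability.\<close>

lemma chain_core_stable: "chain_stable X f chain_core"
  unfolding chain_stable_def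
proof (intro conjI allI impI)
  show "closedin (top_of_set X) chain_core"
    using closed_chain_core by (intro closed_subset) (auto simp: chain_core_def)
  show "f ` chain_core \<subseteq> chain_core"
    using chain_core_image by blast
  fix \<epsilon> :: real assume "\<epsilon> > 0"
  show "\<exists>\<delta>>0. \<forall>k x. delta_chain X f \<delta> k x \<and> x 0 \<in> chain_core \<longrightarrow>
      (\<forall>i\<le>k. infdist (x i) chain_core \<le> \<epsilon>)"
  proof (rule ccontr)
    assume neg: "\<not> ?thesis"
    have "\<exists>a b k. a \<in> chain_core \<and> infdist b chain_core > \<epsilon> \<and> chain_reach X f \<delta> k a b"
      if "\<delta> > 0" for \<delta>
    proof -
      obtain k x i where x: "delta_chain X f \<delta> k x" "x 0 \<in> chain_core" "i \<le> k"
          "infdist (x i) chain_core > \<epsilon>"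
        using neg \<open>\<delta> > 0\<close> by (metis not_le)
      with \<open>\<epsilon> > 0\<close> have "i \<noteq> 0" by (metis infdist_zero less_asym)
      then have "chain_reach X f \<delta> i (x 0) (x i)"
        using x unfolding chain_reach_def delta_chain_def by (intro exI[of _ x]) auto
      with x show ?thesis by blast
    qed
    then have "\<forall>n. \<exists>a b. a \<in> chain_core \<and> infdist b chain_core > \<epsilon> \<and>
        (\<exists>k. chain_reach X f (1 / real (Suc n)) k a b)"
      by (metis divide_pos_pos of_nat_0_less_iff zero_less_Suc zero_less_one)
    then obtain a b where ab: "\<And>n. a n \<in> chain_core" "\<And>n. infdist (b n) chain_core > \<epsilon>"
        "\<And>n. \<exists>k. chain_reach X f (1 / real (Suc n)) k (a n) (b n)"
      by metis
    have "a n \<in> X" "b n \<in> X" for n using ab(3)[of n] chain_reachD(2,3) by blast+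
    then obtain p q r where l: "p \<in> X" "q \<in> X" and r: "strict_mono (r :: nat \<Rightarrow> nat)"
        and lim1: "(\<lambda>n. a (r n)) \<longlonglongrightarrow> p" and lim2: "(\<lambda>n. b (r n)) \<longlonglongrightarrow> q"
      by (rule pair_subsequence)
    have "chain_leads X f p q"
    proof (rule chain_leads_seq_limit[OF _ _ lim1 lim2])
      fix \<delta> :: real assume "\<delta> > 0"
      have "(\<lambda>n. 1 / real (Suc (r n))) \<longlonglongrightarrow> 0"
        using LIMSEQ_subseq_LIMSEQ[OF LIMSEQ_inverse_real_of_nat r] by (simp add: comp_def inverse_eq_divide)
      then have "\<forall>\<^sub>F n in sequentially. 1 / real (Suc (r n)) < \<delta>"
        using \<open>\<delta> > 0\<close> by (rule order_tendstoD)
      then show "\<forall>\<^sub>F n in sequentially. \<exists>k. chain_reach X f \<delta> k (a (r n)) (b (r n))"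
        by eventually_elim (use ab(3) chain_reach_mono less_imp_le in metis)
    qed (use l in auto)
    moreover have "p \<in> chain_core"
      using closed_sequentially[OF closed_chain_core _ lim1] ab(1) by blast
    ultimately have "q \<in> chain_core"
      using chain_core_leads_mem l by auto
    moreover have "\<epsilon> \<le> infdist q chain_core"
      by (rule tendsto_lowerbound[OF tendsto_infdist[OF lim2]])
         (use less_imp_le[OF ab(2)] in simp_all)
    ultimately show False using \<open>\<epsilon> > 0\<close> by simp
  qed
qed

text \<open>Points of \<open>D\<close> lead to a point \<open>c\<close> of the core by \<open>\<delta>\<close>-chains for every \<open>\<delta>\<close>; stability keeps these
  chains arbitrarily close to \<open>D\<close>, so \<open>c\<close> belongs to the closed set \<open>D\<close>.\<close>

lemma chain_stable_component_eq_core: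
  assumes "chain_core \<noteq> {}" "D \<in> chain_components X f" "chain_stable X f D"
  shows "D = chain_core"
proof -
  obtain z where z: "z \<in> D" "z \<in> X"
    using assms(2) unfolding chain_components_def
    by (auto elim!: quotientE simp: chain_equivalence_def chain_recurrent_set_def)
  obtain c where c: "c \<in> chain_core" using assms(1) by blast
  have "closed D"
    using assms(3) compact_imp_closed[OF compact_X] closedin_closed_trans
    unfolding chain_stable_def by blast
  have "infdist c D \<le> \<epsilon>" if "\<epsilon> > 0" for \<epsilon>
  proof -
    obtain \<delta> where \<delta>: "\<delta> > 0" "\<And>k x. delta_chain X f \<delta> k x \<Longrightarrow> x 0 \<in> D \<Longrightarrow> infdist (x k) D \<le> \<epsilon>"
      using assms(3) \<open>\<epsilon> > 0\<close> unfolding chain_stable_def by (meson order_refl)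
    obtain k xs where "delta_chain X f \<delta> k xs" "xs 0 = z" "xs k = c"
      using c z(2) \<delta>(1) unfolding chain_core_def chain_leads_def by blast
    with \<delta>(2) z(1) show ?thesis by blast
  qed
  then have "infdist c D = 0"
    using infdist_nonneg[of c D] by (meson dense_ge order_antisym)
  then have "c \<in> D"
    using \<open>closed D\<close> z(1) in_closed_iff_infdist_zero by blast
  from chain_core_mem_component[OF assms(2) this c] show ?thesis .
qed

lemma chain_stable_components:
  assumes "chain_proximal X f" "X \<noteq> {}"
  shows "{D \<in> chain_components X f. chain_stable X f D} = {chain_core}"
proof -
  note nonempty = chain_core_nonempty[OF assms]
  show ?thesis
  proof (intro equalityI subsetI)
    fix D assume "D \<in> {D \<in> chain_components X f. chain_stable X f D}"
    then show "D \<in> {chain_core}" using chain_stable_component_eq_core[OF nonempty] by simp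
  next
    fix D assume "D \<in> {chain_core}"
    then show "D \<in> {D \<in> chain_components X f. chain_stable X f D}"
      using chain_core_component[OF nonempty] chain_core_stable by simp
  qed
qed

text \<open>Proximality of \<open>z\<close> and \<open>f z\<close> closes up to loops at \<open>z\<close> of two consecutive lengths, and these
  generate loops of all large lengths.\<close>

lemma chain_mixing_into_core:
  assumes "chain_proximal X f" "z \<in> chain_core" "x \<in> X" "\<delta> > 0"
  shows "\<exists>K. \<forall>n\<ge>K. chain_reach X f \<delta> n x z"
proof -
  have "z \<in> X" using assms(2) by (simp add: chain_core_def)
  \<comment> \<open>Chains have positive length; 0 is added to make \<open>S\<close> a monoid of loop lengths.\<close>
  define S where "S = {k. k = 0 \<or> chain_reach X f \<delta> k z z}"
  obtain k w where kw: "chain_reach X f \<delta> k z w" "chain_reach X f \<delta> k (f z) w"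
    using assms(1,4) \<open>z \<in> X\<close> f_mem unfolding chain_proximal_iff by blast
  have "chain_reach X f \<delta> 1 z (f z)"
    using \<open>z \<in> X\<close> assms(4) by (intro chain_reach_step) (auto intro: f_mem)
  note longer = chain_reach_trans[OF this kw(2)]
  have "chain_leads X f w z" "chain_leads X f x z"
    using assms(2,3) chain_reachD(3)[OF kw(1)] by (auto simp: chain_core_def)
  then obtain m a where m: "chain_reach X f \<delta> m w z" and a: "chain_reach X f \<delta> a x z"
    using assms(4) unfolding chain_leads_iff by blast
  define l where "l = k + m"
  have "l \<in> S" "l + 1 \<in> S" "0 \<in> S"
    using chain_reach_trans[OF kw(1) m] chain_reach_trans[OF longer m] by (auto simp: S_def l_def)
  moreover have "i + j \<in> S" if "i \<in> S" "j \<in> S" for i j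
    using that by (auto simp: S_def intro: chain_reach_trans)
  moreover have "l > 0" using chain_reachD(1)[OF m] by (simp add: l_def)
  ultimately have loops: "i \<in> S" if "i \<ge> l * l" for i
    using add_closed_contains_all_large[of S l i] that by blast
  have "chain_reach X f \<delta> n x z" if "n \<ge> a + l * l" for n
  proof -
    have "n - a \<in> S" using that by (intro loops) simp
    moreover have n: "n = a + (n - a)" using that by simp
    ultimately consider "n = a" | "chain_reach X f \<delta> (n - a) z z" by (auto simp: S_def)
    then show ?thesis
      using a chain_reach_trans[OF a, of "n - a" z] n by cases auto
  qed
  then show ?thesis by blast
qed

end

section \<open>Dense and residual sets of pairs\<close>

lemma dense_in_Times_iff:
  fixes X :: "'a::metric_space set"
  shows "dense_in (top_of_set (X \<times> X)) D \<longleftrightarrow> D \<subseteq> X \<times> X \<and>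
    (\<forall>x\<in>X. \<forall>y\<in>X. \<forall>\<epsilon>>0. \<exists>x' y'. (x', y') \<in> D \<and> dist x' x < \<epsilon> \<and> dist y' y < \<epsilon>)"
proof -
  have closure: "(x, y) \<in> closure D \<longleftrightarrow>
      (\<forall>\<epsilon>>0. \<exists>x' y'. (x', y') \<in> D \<and> dist x' x < \<epsilon> \<and> dist y' y < \<epsilon>)" for x y
    unfolding closure_approachable
  proof (intro iffI allI impI)
    fix \<epsilon> :: real assume "\<forall>\<epsilon>>0. \<exists>q\<in>D. dist q (x, y) < \<epsilon>" "\<epsilon> > 0"
    then obtain q where "q \<in> D" "dist q (x, y) < \<epsilon>" by blast
    then show "\<exists>x' y'. (x', y') \<in> D \<and> dist x' x < \<epsilon> \<and> dist y' y < \<epsilon>"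
      using dist_fst_le[of q "(x, y)"] dist_snd_le[of q "(x, y)"]
      by (intro exI[of _ "fst q"] exI[of _ "snd q"]) auto
  next
    fix \<epsilon> :: real
    assume approx: "\<forall>\<epsilon>>0. \<exists>x' y'. (x', y') \<in> D \<and> dist x' x < \<epsilon> \<and> dist y' y < \<epsilon>" and "\<epsilon> > 0"
    then obtain x' y' where q: "(x', y') \<in> D" "dist x' x < \<epsilon> / 2" "dist y' y < \<epsilon> / 2"
      by (meson half_gt_zero)
    have "dist (x', y') (x, y) \<le> dist x' x + dist y' y"
      unfolding dist_Pair_Pair by (rule sqrt_sum_squares_le_sum) auto
    with q show "\<exists>q\<in>D. dist q (x, y) < \<epsilon>" by force
  qed
  have "top_of_set (X \<times> X) closure_of D = X \<times> X \<inter> closure D" if "D \<subseteq> X \<times> X"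
    using that by (simp add: closure_of_subtopology inf.absorb2)
  moreover have "X \<times> X \<inter> closure D = X \<times> X \<longleftrightarrow> (\<forall>x\<in>X. \<forall>y\<in>X. (x, y) \<in> closure D)"
    by blast
  ultimately show ?thesis
    unfolding dense_in_def closure by auto
qed

lemma residual_in_mono: "residual_in T S \<Longrightarrow> S \<subseteq> S' \<Longrightarrow> S' \<subseteq> topspace T \<Longrightarrow> residual_in T S'"
  unfolding residual_in_def by (meson subset_trans)

lemma residual_in_countable_Inter:
  assumes "countable I" "\<And>i. i \<in> I \<Longrightarrow> openin T (U i)" "\<And>i. i \<in> I \<Longrightarrow> dense_in T (U i)"
  shows "residual_in T (topspace T \<inter> (\<Inter>i\<in>I. U i))"
  unfolding residual_in_def using assms by (intro conjI exI[of _ "U ` I"]) auto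

lemma residual_in_Int:
  assumes "residual_in T S" "residual_in T S'"
  shows "residual_in T (S \<inter> S')"
proof -
  obtain \<U> \<V> where "countable \<U>" "\<forall>U\<in>\<U>. openin T U \<and> dense_in T U" "topspace T \<inter> \<Inter>\<U> \<subseteq> S"
      "countable \<V>" "\<forall>U\<in>\<V>. openin T U \<and> dense_in T U" "topspace T \<inter> \<Inter>\<V> \<subseteq> S'"
    using assms unfolding residual_in_def by blast
  then show ?thesis
    unfolding residual_in_def using assms
    by (intro conjI exI[of _ "\<U> \<union> \<V>"]) (auto simp: residual_in_def)
qed

text \<open>A compact Hausdorff space is a Baire space.\<close>

lemma residual_in_imp_dense_in:
  fixes S :: "'b::metric_space set"
  assumes "compact S" "residual_in (top_of_set S) D"
  shows "dense_in (top_of_set S) D"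
proof -
  let ?T = "top_of_set S"
  obtain \<U> where U: "countable \<U>" "\<forall>U\<in>\<U>. openin ?T U \<and> dense_in ?T U"
      "topspace ?T \<inter> \<Inter>\<U> \<subseteq> D" "D \<subseteq> topspace ?T"
    using assms(2) unfolding residual_in_def by blast
  have "compact_space ?T" using assms(1) by (simp add: compact_space_subtopology)
  moreover have "Hausdorff_space ?T" by (simp add: Hausdorff_space_subtopology)
  ultimately have "locally_compact_space ?T \<and> regular_space ?T"
    by (simp add: compact_imp_locally_compact_space compact_Hausdorff_imp_regular_space)
  then have "?T closure_of \<Inter>\<U> = topspace ?T"
    using U by (intro Baire_category) (auto simp: dense_in_def)
  moreover have "?T closure_of \<Inter>\<U> = ?T closure_of (topspace ?T \<inter> \<Inter>\<U>)"
    by (rule closure_of_restrict)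
  moreover have "?T closure_of (topspace ?T \<inter> \<Inter>\<U>) \<subseteq> ?T closure_of D"
    using U(3) by (rule closure_of_mono)
  ultimately show ?thesis
    using U(4) closure_of_subset_topspace[of ?T D] unfolding dense_in_def by blast
qed

text \<open>Crowdedness of \<open>{i. P i p}\<close> is witnessed by finitely many indices, so that it is an open
  condition on \<open>p\<close> if each \<open>P i\<close> is.\<close>

lemma openin_crowded:
  assumes "\<And>i. openin T {p \<in> topspace T. P i p}"
  shows "openin T {p \<in> topspace T. crowded n {i. P i p}}"
proof (subst openin_subopen, intro ballI)
  fix p assume "p \<in> {p \<in> topspace T. crowded n {i. P i p}}"
  then have p: "p \<in> topspace T" "crowded n {i. P i p}" by auto
  obtain B where B: "finite B" "B \<subseteq> {i. P i p}" "\<And>A. B \<subseteq> A \<Longrightarrow> crowded n A"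
    using crowded_finite_witness[OF p(2)] by blast
  have "openin T ((\<Inter>i\<in>B. {q \<in> topspace T. P i q}) \<inter> topspace T)"
    using B(1) assms by (intro openin_INT) auto
  moreover have "p \<in> (\<Inter>i\<in>B. {q \<in> topspace T. P i q}) \<inter> topspace T"
    using p(1) B(2) by auto
  moreover have "(\<Inter>i\<in>B. {q \<in> topspace T. P i q}) \<inter> topspace T \<subseteq>
      {p \<in> topspace T. crowded n {i. P i p}}"
    by (auto intro!: B(3))
  ultimately show "\<exists>U. openin T U \<and> p \<in> U \<and> U \<subseteq> {p \<in> topspace T. crowded n {i. P i p}}"
    by blast
qed

section \<open>Distal pairs and property S\<close>

context compact_system
begin

lemma follow_orbits_after_chains:
  assumes "chain_reach X f \<delta> n x p" "chain_reach X f \<delta> n y q" "\<delta> > 0"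
  obtains xs ys where "pseudo_orbit X f \<delta> xs" "pseudo_orbit X f \<delta> ys" "xs 0 = x" "ys 0 = y"
    "\<And>i. xs (n + i) = (f ^^ i) p" "\<And>i. ys (n + i) = (f ^^ i) q"
proof -
  have "pseudo_orbit X f \<delta> (\<lambda>i. (f ^^ i) p)" "pseudo_orbit X f \<delta> (\<lambda>i. (f ^^ i) q)"
    using assms chain_reachD(3) by (auto intro!: orbit_pseudo_orbit)
  from chain_then_pseudo_orbit[OF assms(1) this(1)] chain_then_pseudo_orbit[OF assms(2) this(2)]
  show thesis using that by auto
qed

text \<open>Both chains have the same length, so that afterwards the two orbits are run through
  simultaneously. The strict inequality in property S is the reason for halving \<open>c\<close>.\<close>

lemma property_S_if_chains_to_distal_pairs:
  assumes "c > 0"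
    and "\<And>x y \<delta>. x \<in> X \<Longrightarrow> y \<in> X \<Longrightarrow> \<delta> > 0 \<Longrightarrow>
      \<exists>n p q. chain_reach X f \<delta> n x p \<and> chain_reach X f \<delta> n y q \<and>
        (\<forall>i. c \<le> dist ((f ^^ i) p) ((f ^^ i) q))"
  shows "property_S X f"
  unfolding property_S_def
proof (intro exI[of _ "c / 2"] conjI ballI allI impI)
  fix x y \<delta> assume "x \<in> X" "y \<in> X" "\<delta> > (0::real)"
  then obtain n p q where n: "chain_reach X f \<delta> n x p" "chain_reach X f \<delta> n y q"
      and far: "\<And>i. c \<le> dist ((f ^^ i) p) ((f ^^ i) q)"
    using assms(2) by blast
  obtain xs ys where orbits: "pseudo_orbit X f \<delta> xs" "pseudo_orbit X f \<delta> ys" "xs 0 = x" "ys 0 = y"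
      and tail: "\<And>i. xs (n + i) = (f ^^ i) p" "\<And>i. ys (n + i) = (f ^^ i) q"
    using follow_orbits_after_chains[OF n \<open>\<delta> > 0\<close>] by blast
  have "c \<le> dist (xs i) (ys i)" if "i \<ge> n" for i
    using far[of "i - n"] tail[of "i - n"] that by simp
  then have "ereal c \<le> liminf (\<lambda>i. ereal (dist (xs i) (ys i)))"
    by (intro Liminf_bounded) (auto simp: eventually_at_top_linorder)
  moreover have "ereal (c / 2) < ereal c" using assms(1) by simp
  ultimately have "ereal (c / 2) < liminf (\<lambda>i. ereal (dist (xs i) (ys i)))"
    by (rule less_le_trans[rotated])
  with orbits show "\<exists>xs ys. pseudo_orbit X f \<delta> xs \<and> pseudo_orbit X f \<delta> ys \<and> xs 0 = x \<and> ys 0 = y \<and>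
      liminf (\<lambda>i. ereal (dist (xs i) (ys i))) > ereal (c / 2)"
    by blast
qed (use assms(1) in simp)

lemma distal_pair_iff: "distal_pair f x y \<longleftrightarrow> (\<exists>c>0. \<forall>i. c \<le> dist ((f ^^ i) x) ((f ^^ i) y))"
proof
  let ?d = "\<lambda>i. dist ((f ^^ i) x) ((f ^^ i) y)"
  assume "distal_pair f x y"
  moreover have "(INF i. ?d i) \<le> ?d i" for i
    by (intro cINF_lower bdd_belowI[of _ 0]) auto
  ultimately show "\<exists>c>0. \<forall>i. c \<le> ?d i" unfolding distal_pair_def by blast
next
  assume "\<exists>c>0. \<forall>i. c \<le> dist ((f ^^ i) x) ((f ^^ i) y)"
  then show "distal_pair f x y"
    unfolding distal_pair_def by (meson UNIV_not_empty cINF_greatest less_le_trans)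
qed

text \<open>Chains into the core exist in all large lengths, in particular in a common length for the two
  members of the pair.\<close>

lemma property_S_if_distal_pair_in_core:
  assumes "chain_proximal X f" "p \<in> chain_core" "q \<in> chain_core" "distal_pair f p q"
  shows "property_S X f"
proof -
  obtain c where c: "c > 0" "\<forall>i. c \<le> dist ((f ^^ i) p) ((f ^^ i) q)"
    using assms(4) unfolding distal_pair_iff by blast
  show ?thesis
  proof (rule property_S_if_chains_to_distal_pairs[OF c(1)])
    fix x y \<delta> assume "x \<in> X" "y \<in> X" "\<delta> > (0::real)"
    then obtain K L where "\<forall>n\<ge>K. chain_reach X f \<delta> n x p" "\<forall>n\<ge>L. chain_reach X f \<delta> n y q"
      using chain_mixing_into_core assms by meson
    then show "\<exists>n p q. chain_reach X f \<delta> n x p \<and> chain_reach X f \<delta> n y q \<and>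
        (\<forall>i. c \<le> dist ((f ^^ i) p) ((f ^^ i) q))"
      using c(2) by (intro exI[of _ "max K L"] exI[of _ p] exI[of _ q]) auto
  qed
qed

lemma pseudo_orbit_limit:
  assumes "\<And>n. pseudo_orbit X f (\<eta> n) (u n)" "\<eta> \<longlonglongrightarrow> 0" "p \<in> X" "(\<lambda>n. u n 0) \<longlonglongrightarrow> p"
  shows "(\<lambda>n. u n i) \<longlonglongrightarrow> (f ^^ i) p"
proof (induction i)
  case (Suc i)
  have mem: "u n i \<in> X" for n i using assms(1) by (simp add: pseudo_orbit_def)
  have "(\<lambda>n. f (u n i)) \<longlonglongrightarrow> f ((f ^^ i) p)"
    using mem by (intro continuous_on_tendsto_compose[OF f_cont Suc] iterate_mem assms(3)) auto
  from tendsto_add[OF assms(2) tendsto_dist[OF this tendsto_const[of "f ((f ^^ i) p)"]]]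
  have bound: "(\<lambda>n. \<eta> n + dist (f (u n i)) (f ((f ^^ i) p))) \<longlonglongrightarrow> 0" by simp
  have "dist (u n (Suc i)) (f ((f ^^ i) p)) \<le> \<eta> n + dist (f (u n i)) (f ((f ^^ i) p))" for n
    using assms(1)[of n] dist_triangle3[of "u n (Suc i)" "f ((f ^^ i) p)" "f (u n i)"]
    unfolding pseudo_orbit_def by (meson add_right_mono order_trans)
  then have "(\<lambda>n. dist (u n (Suc i)) (f ((f ^^ i) p))) \<longlonglongrightarrow> 0"
    by (intro tendsto_sandwich[OF _ _ tendsto_const bound]) simp_all
  then have "(\<lambda>n. u n (Suc i)) \<longlonglongrightarrow> f ((f ^^ i) p)"
    by (rule tendsto_dist_iff[THEN iffD2])
  then show ?case by simp
qed (simp add: assms(4))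

text \<open>Start pairs of pseudo orbits of decreasing error at a point \<open>c\<close> of the core. Their points at a time
  from which on they stay apart converge along a subsequence, the limits are reached from \<open>c\<close> and
  hence lie in the core, and their orbits are the limits of the pseudo orbits.\<close>

lemma distal_pair_in_core_if_property_S:
  assumes "property_S X f" "c \<in> chain_core"
  shows "\<exists>p\<in>chain_core. \<exists>q\<in>chain_core. distal_pair f p q"
proof -
  have "c \<in> X" using assms(2) by (simp add: chain_core_def)
  define \<eta> where "\<eta> n = inverse (real (Suc n))" for n
  have \<eta>: "\<eta> n > 0" for n by (simp add: \<eta>_def)
  obtain e where e: "e > 0" "\<And>\<delta>. \<delta> > 0 \<Longrightarrow> \<exists>xs ys. pseudo_orbit X f \<delta> xs \<and> pseudo_orbit X f \<delta> ys \<and>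
      xs 0 = c \<and> ys 0 = c \<and> liminf (\<lambda>i. ereal (dist (xs i) (ys i))) > ereal e"
    using assms(1) \<open>c \<in> X\<close> unfolding property_S_def by meson
  \<comment> \<open>Shifted tails: pseudo orbits that are apart from their first point on.\<close>
  have "\<exists>u v. pseudo_orbit X f (\<eta> n) u \<and> pseudo_orbit X f (\<eta> n) v \<and>
      (\<exists>k. chain_reach X f (\<eta> n) k c (u 0)) \<and> (\<exists>k. chain_reach X f (\<eta> n) k c (v 0)) \<and>
      (\<forall>i. e \<le> dist (u i) (v i))" for n
  proof -
    obtain xs ys where xs: "pseudo_orbit X f (\<eta> n) xs" "xs 0 = c"
        and ys: "pseudo_orbit X f (\<eta> n) ys" "ys 0 = c"
        and lim: "ereal e < liminf (\<lambda>i. ereal (dist (xs i) (ys i)))"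
      using e(2)[OF \<eta>[of n]] by blast
    obtain N where N: "\<And>i. i \<ge> N \<Longrightarrow> e < dist (xs i) (ys i)"
      using less_LiminfD[OF lim] by (auto simp: eventually_at_top_linorder)
    show ?thesis
      using xs ys N chain_reach_pseudo_orbit[OF xs(1), of "Suc N"]
        chain_reach_pseudo_orbit[OF ys(1), of "Suc N"]
      by (intro exI[of _ "\<lambda>i. xs (Suc N + i)"] exI[of _ "\<lambda>i. ys (Suc N + i)"])
        (auto simp: pseudo_orbit_def intro: less_imp_le)
  qed
  then obtain u v where uv: "\<And>n. pseudo_orbit X f (\<eta> n) (u n)" "\<And>n. pseudo_orbit X f (\<eta> n) (v n)"
      and reach: "\<And>n. \<exists>k. chain_reach X f (\<eta> n) k c (u n 0)" "\<And>n. \<exists>k. chain_reach X f (\<eta> n) k c (v n 0)"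
      and far: "\<And>n i. e \<le> dist (u n i) (v n i)"
    by metis
  have "u n 0 \<in> X" "v n 0 \<in> X" for n using uv by (auto simp: pseudo_orbit_def)
  then obtain p q r where pq: "p \<in> X" "q \<in> X" and r: "strict_mono (r :: nat \<Rightarrow> nat)"
      and lim: "(\<lambda>n. u (r n) 0) \<longlonglongrightarrow> p" "(\<lambda>n. v (r n) 0) \<longlonglongrightarrow> q"
    by (rule pair_subsequence)
  have \<eta>_lim: "(\<lambda>n. \<eta> (r n)) \<longlonglongrightarrow> 0"
    using LIMSEQ_subseq_LIMSEQ[OF LIMSEQ_inverse_real_of_nat r] by (simp add: comp_def \<eta>_def)
  have core: "a \<in> chain_core" if "a \<in> X" "(\<lambda>n. w (r n)) \<longlonglongrightarrow> a"
    "\<And>n. \<exists>k. chain_reach X f (\<eta> n) k c (w n)" for a w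
  proof (rule chain_core_leads_mem[OF assms(2) that(1)],
      rule chain_leads_seq_limit[OF \<open>c \<in> X\<close> that(1) tendsto_const that(2)])
    fix \<delta> :: real assume "\<delta> > 0"
    with \<eta>_lim have "\<forall>\<^sub>F n in sequentially. \<eta> (r n) < \<delta>" by (rule order_tendstoD)
    then show "\<forall>\<^sub>F n in sequentially. \<exists>k. chain_reach X f \<delta> k c (w (r n))"
      by eventually_elim (use that(3) chain_reach_mono less_imp_le in metis)
  qed
  have "e \<le> dist ((f ^^ i) p) ((f ^^ i) q)" for i
    by (rule tendsto_lowerbound[OF tendsto_dist[OF
          pseudo_orbit_limit[OF uv(1) \<eta>_lim pq(1) lim(1), of i]
          pseudo_orbit_limit[OF uv(2) \<eta>_lim pq(2) lim(2), of i]]])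
      (use far in auto)
  with e(1) have "distal_pair f p q" unfolding distal_pair_iff by blast
  moreover have "p \<in> chain_core" "q \<in> chain_core"
    using core[OF pq(1), of "\<lambda>n. u n 0"] core[OF pq(2), of "\<lambda>n. v n 0"] lim reach by blast+
  ultimately show ?thesis by blast
qed

section \<open>Consequences of distributionally chaotic pairs\<close>

text \<open>The orbits of the two points stay apart during arbitrarily long periods; a limit of the states
  at the middle of these periods is a pair that stays apart forever. Starting at the middle makes
  the times \<open>m n\<close> tend to infinity.\<close>

lemma distal_limit_pair:
  assumes "x \<in> X" "y \<in> X" and crowded: "\<And>n. crowded n {i. \<delta> \<le> dist ((f ^^ i) x) ((f ^^ i) y)}"
  obtains p q m where "p \<in> X" "q \<in> X" "\<And>i. \<delta> \<le> dist ((f ^^ i) p) ((f ^^ i) q)"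
    "\<And>n. n \<le> m n" "(\<lambda>n. (f ^^ m n) x) \<longlonglongrightarrow> p" "(\<lambda>n. (f ^^ m n) y) \<longlonglongrightarrow> q"
proof -
  have "\<exists>s\<ge>n. \<forall>i<n. \<delta> \<le> dist ((f ^^ (s + i)) x) ((f ^^ (s + i)) y)" for n
  proof (cases "n = 0")
    case False
    then obtain s where s: "{s..<s + (n + n)} \<subseteq> {i. \<delta> \<le> dist ((f ^^ i) x) ((f ^^ i) y)}"
      using crowded_imp_run[of "n + n", OF crowded] by auto
    have "\<delta> \<le> dist ((f ^^ (s + n + i)) x) ((f ^^ (s + n + i)) y)" if "i < n" for i
    proof -
      have "s + n + i \<in> {s..<s + (n + n)}" using that by simp
      with s show ?thesis by blast
    qed
    then show ?thesis by (intro exI[of _ "s + n"]) auto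
  qed auto
  then obtain s where s: "\<And>n. s n \<ge> n"
      "\<And>n i. i < n \<Longrightarrow> \<delta> \<le> dist ((f ^^ (s n + i)) x) ((f ^^ (s n + i)) y)"
    by metis
  obtain p q r where pq: "p \<in> X" "q \<in> X" and r: "strict_mono (r :: nat \<Rightarrow> nat)"
      and lim: "(\<lambda>n. (f ^^ s (r n)) x) \<longlonglongrightarrow> p" "(\<lambda>n. (f ^^ s (r n)) y) \<longlonglongrightarrow> q"
    using assms(1,2) by (rule pair_subsequence[OF iterate_mem iterate_mem])
  have shift: "(\<lambda>n. (f ^^ (s (r n) + i)) z) \<longlonglongrightarrow> (f ^^ i) a"
    if "(\<lambda>n. (f ^^ s (r n)) z) \<longlonglongrightarrow> a" "z \<in> X" "a \<in> X" for z a i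
    using continuous_on_tendsto_compose[OF iterate_cont that(1,3), of i] iterate_mem[OF that(2)]
    by (simp add: add.commute[of _ i] funpow_add)
  have "\<delta> \<le> dist ((f ^^ i) p) ((f ^^ i) q)" for i
  proof (rule tendsto_lowerbound[OF tendsto_dist[OF
          shift[OF lim(1) assms(1) pq(1)] shift[OF lim(2) assms(2) pq(2)]]])
    have "\<delta> \<le> dist ((f ^^ (s (r n) + i)) x) ((f ^^ (s (r n) + i)) y)" if "n > i" for n
      using seq_suble[OF r, of n] that by (intro s(2)) simp
    then show "\<forall>\<^sub>F n in sequentially. \<delta> \<le> dist ((f ^^ (s (r n) + i)) x) ((f ^^ (s (r n) + i)) y)"
      by (auto simp: eventually_at_top_dense)
  qed simp
  moreover have "n \<le> s (r n)" for n
    using seq_suble[OF r, of n] s(1)[of "r n"] by linarith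
  ultimately show thesis
    using pq lim by (intro that[of p q "\<lambda>n. s (r n)"]) auto
qed

text \<open>A jump from \<open>f a\<close> onto the orbit of \<open>x\<close>, a segment of this orbit, and a jump to \<open>p\<close> at its end. The
  two errors add up when the segment is a single step.\<close>

lemma chain_reach_via_orbit_segment:
  assumes "a \<in> X" "x \<in> X" "p \<in> X" "m < n"
    and "dist (f a) (f ((f ^^ m) x)) \<le> \<delta> / 2" "dist ((f ^^ n) x) p \<le> \<delta> / 2"
  shows "chain_reach X f \<delta> (n - m) a p"
  using chain_reach_change_end[OF chain_reach_change_start[OF
        chain_reach_orbit[OF assms(2,4)] assms(1,5)] assms(3,6)] by simp

text \<open>Only the images of the approximating points have to be close: the first jump of a chain goes from
  \<open>f x\<close> to \<open>f x'\<close>.\<close>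

lemma close_approximation:
  assumes dense: "dense_in (top_of_set (X \<times> X)) D" and "x \<in> X" "y \<in> X" "\<eta> > 0"
  obtains x' y' where "(x', y') \<in> D" "x' \<in> X" "y' \<in> X"
    "dist (f x) (f x') \<le> \<eta>" "dist (f y) (f y') \<le> \<eta>"
proof -
  obtain d1 d2 where d: "d1 > 0" "\<forall>z\<in>X. dist z x < d1 \<longrightarrow> dist (f z) (f x) < \<eta>"
      "d2 > 0" "\<forall>z\<in>X. dist z y < d2 \<longrightarrow> dist (f z) (f y) < \<eta>"
    using continuity_at[OF assms(2,4)] continuity_at[OF assms(3,4)] by blast
  then have "min d1 d2 > 0" by simp
  then obtain x' y' where "(x', y') \<in> D" "dist x' x < min d1 d2" "dist y' y < min d1 d2"
    using dense assms(2,3) unfolding dense_in_Times_iff by blast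
  moreover have "D \<subseteq> X \<times> X" using dense unfolding dense_in_Times_iff by blast
  ultimately show thesis
    using d by (intro that[of x' y']) (auto simp: dist_commute intro: less_imp_le)
qed

text \<open>Both chains follow the orbits of a nearby DC1 pair until these are close, and end at the same
  point of one of them.\<close>

lemma chain_proximal_if_dense_DC1:
  assumes "dense_in (top_of_set (X \<times> X)) (DC1 X f)"
  shows "chain_proximal X f"
  unfolding chain_proximal_iff
proof (intro ballI allI impI)
  fix x y and \<delta> :: real assume xy: "x \<in> X" "y \<in> X" and "\<delta> > 0"
  then obtain x' y' where x'y': "(x', y') \<in> DC1 X f" "x' \<in> X" "y' \<in> X"
      and near: "dist (f x) (f x') \<le> \<delta> / 2" "dist (f y) (f y') \<le> \<delta> / 2"
    using close_approximation[OF assms, of x y "\<delta> / 2"] by auto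
  \<comment> \<open>A run of length 2 contains a positive time, as needed for the length of a chain.\<close>
  have "crowded (2 * 2) {i. dist ((f ^^ i) x') ((f ^^ i) y') < \<delta> / 2}"
    using x'y'(1) half_gt_zero[OF \<open>\<delta> > 0\<close>] unfolding DC1_def by (auto simp only: UN_iff DC1_delta_iff)
  then obtain m where m: "{m..<m + 2} \<subseteq> {i. dist ((f ^^ i) x') ((f ^^ i) y') < \<delta> / 2}"
    using crowded_imp_run[of 2] by auto
  have "Suc m \<in> {m..<m + 2}" by simp
  with m have "dist ((f ^^ Suc m) y') ((f ^^ Suc m) x') \<le> \<delta> / 2"
    by (auto simp only: dist_commute less_imp_le)
  with near xy x'y' \<open>\<delta> > 0\<close> iterate_mem[OF x'y'(2), of "Suc m"]
  have "chain_reach X f \<delta> (Suc m - 0) x ((f ^^ Suc m) x')"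
    "chain_reach X f \<delta> (Suc m - 0) y ((f ^^ Suc m) x')"
    using chain_reach_via_orbit_segment[of x x' "(f ^^ Suc m) x'" 0 "Suc m"]
      chain_reach_via_orbit_segment[of y y' "(f ^^ Suc m) x'" 0 "Suc m"]
    by simp_all
  then show "\<exists>k w. chain_reach X f \<delta> k x w \<and> chain_reach X f \<delta> k y w" by blast
qed

text \<open>Every pair is led, along the orbits of a nearby chaotic pair, to a distal pair with the same
  constant \<open>c\<close>.\<close>

lemma property_S_if_duDC1:
  assumes "duDC1 X f"
  shows "property_S X f"
proof -
  obtain c where c: "c > 0" and dense: "dense_in (top_of_set (X \<times> X)) (DC1_delta X f c)"
    using assms unfolding duDC1_def by blast
  show ?thesis
  proof (rule property_S_if_chains_to_distal_pairs[OF c])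
    fix x y and \<delta> :: real assume xy: "x \<in> X" "y \<in> X" and "\<delta> > 0"
    then obtain x' y' where x'y': "(x', y') \<in> DC1_delta X f c" "x' \<in> X" "y' \<in> X"
        and near: "dist (f x) (f x') \<le> \<delta> / 2" "dist (f y) (f y') \<le> \<delta> / 2"
      using close_approximation[OF dense, of x y "\<delta> / 2"] by auto
    have "crowded n {i. c \<le> dist ((f ^^ i) x') ((f ^^ i) y')}" for n
      using x'y'(1) by (simp add: DC1_delta_iff)
    then obtain p q m where pq: "p \<in> X" "q \<in> X" "\<And>i. c \<le> dist ((f ^^ i) p) ((f ^^ i) q)"
        and m: "\<And>n. n \<le> m n" and lim: "(\<lambda>n. (f ^^ m n) x') \<longlonglongrightarrow> p" "(\<lambda>n. (f ^^ m n) y') \<longlonglongrightarrow> q"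
      using distal_limit_pair[OF x'y'(2,3)] by blast
    have "\<forall>\<^sub>F n in sequentially. dist ((f ^^ m n) x') p < \<delta> / 2 \<and> dist ((f ^^ m n) y') q < \<delta> / 2 \<and> n \<ge> 1"
      using \<open>\<delta> > 0\<close> by (intro eventually_conj tendstoD lim eventually_ge_at_top) auto
    then obtain n where n: "dist ((f ^^ m n) x') p < \<delta> / 2" "dist ((f ^^ m n) y') q < \<delta> / 2" "n \<ge> 1"
      using eventually_happens' sequentially_bot by blast
    have "chain_reach X f \<delta> (m n - 0) x p" "chain_reach X f \<delta> (m n - 0) y q"
      using near xy x'y' pq n m[of n] chain_reach_via_orbit_segment[of x x' p 0 "m n"]
        chain_reach_via_orbit_segment[of y y' q 0 "m n"]
      by simp_all
    with pq(3) show "\<exists>n p q. chain_reach X f \<delta> n x p \<and> chain_reach X f \<delta> n y q \<and>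
        (\<forall>i. c \<le> dist ((f ^^ i) p) ((f ^^ i) q))"
      by blast
  qed
qed

end

section \<open>Generic pairs of a map with the shadowing property\<close>

locale shadowing_system = compact_system +
  assumes shadowing: "shadowing_property X f"
begin

lemma shadowing_orbits:
  assumes "\<epsilon> > 0"
  obtains \<delta> where "\<delta> > 0"
    "\<And>xs. pseudo_orbit X f \<delta> xs \<Longrightarrow> \<exists>z\<in>X. \<forall>i. dist ((f ^^ i) z) (xs i) \<le> \<epsilon>"
  using shadowing assms unfolding shadowing_property_def shadowed_by_def by meson

lemma openin_iterate_distance:
  assumes "open U"
  shows "openin (top_of_set (X \<times> X)) {p \<in> X \<times> X. dist ((f ^^ i) (fst p)) ((f ^^ i) (snd p)) \<in> U}"
proof -
  have "continuous_on (X \<times> X) (\<lambda>p. dist ((f ^^ i) (fst p)) ((f ^^ i) (snd p)))"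
    by (intro continuous_on_dist continuous_on_compose2[OF iterate_cont] continuous_on_fst
        continuous_on_snd continuous_on_id) auto
  from continuous_openin_preimage_gen[OF this assms] show ?thesis
    by (simp add: vimage_def Int_def)
qed

lemma openin_crowded_distances:
  assumes "open U"
  shows "openin (top_of_set (X \<times> X))
    {p \<in> X \<times> X. crowded n {i. dist ((f ^^ i) (fst p)) ((f ^^ i) (snd p)) \<in> U}}"
  using openin_crowded[of "top_of_set (X \<times> X)"
      "\<lambda>i p. dist ((f ^^ i) (fst p)) ((f ^^ i) (snd p)) \<in> U" n] openin_iterate_distance[OF assms]
  by simp

text \<open>A shadowing point is close to the first point of its pseudo orbit. It therefore suffices to
  arrange \<open>Q\<close> for pseudo orbits from arbitrary starting points, provided that \<open>P\<close> follows for all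
  points that shadow them within some fixed distance.\<close>

lemma dense_in_if_shadowed:
  assumes "\<epsilon>\<^sub>0 > 0"
    and approx: "\<And>x y \<delta>. x \<in> X \<Longrightarrow> y \<in> X \<Longrightarrow> \<delta> > 0 \<Longrightarrow>
      \<exists>xs ys. pseudo_orbit X f \<delta> xs \<and> pseudo_orbit X f \<delta> ys \<and> xs 0 = x \<and> ys 0 = y \<and> Q xs ys"
    and transfer: "\<And>xs ys z w. Q xs ys \<Longrightarrow> (\<And>i. dist ((f ^^ i) z) (xs i) \<le> \<epsilon>\<^sub>0) \<Longrightarrow>
      (\<And>i. dist ((f ^^ i) w) (ys i) \<le> \<epsilon>\<^sub>0) \<Longrightarrow> P (z, w)"
  shows "dense_in (top_of_set (X \<times> X)) {p \<in> X \<times> X. P p}"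
  unfolding dense_in_Times_iff
proof (intro conjI ballI allI impI)
  fix x y and \<epsilon> :: real assume xy: "x \<in> X" "y \<in> X" and "\<epsilon> > 0"
  define \<epsilon>' where "\<epsilon>' = min (\<epsilon> / 2) \<epsilon>\<^sub>0"
  have \<epsilon>': "\<epsilon>' > 0" "\<epsilon>' < \<epsilon>" "\<epsilon>' \<le> \<epsilon>\<^sub>0" using \<open>\<epsilon> > 0\<close> assms(1) by (auto simp: \<epsilon>'_def)
  obtain \<delta> where \<delta>: "\<delta> > 0"
    "\<And>xs. pseudo_orbit X f \<delta> xs \<Longrightarrow> \<exists>z\<in>X. \<forall>i. dist ((f ^^ i) z) (xs i) \<le> \<epsilon>'"
    using shadowing_orbits[OF \<epsilon>'(1)] by blast
  obtain xs ys where xs: "pseudo_orbit X f \<delta> xs" "xs 0 = x" and ys: "pseudo_orbit X f \<delta> ys" "ys 0 = y"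
      and Q: "Q xs ys"
    using approx[OF xy \<delta>(1)] by blast
  obtain z where z: "z \<in> X" "\<And>i. dist ((f ^^ i) z) (xs i) \<le> \<epsilon>'" using \<delta>(2)[OF xs(1)] by blast
  obtain w where w: "w \<in> X" "\<And>i. dist ((f ^^ i) w) (ys i) \<le> \<epsilon>'" using \<delta>(2)[OF ys(1)] by blast
  have "P (z, w)"
    using z(2) w(2) \<epsilon>'(3) by (intro transfer[OF Q]) (meson order_trans)+
  moreover have "dist z x < \<epsilon>" "dist w y < \<epsilon>"
    using z(2)[of 0] w(2)[of 0] xs(2) ys(2) \<epsilon>'(2) by auto
  ultimately show "\<exists>x' y'. (x', y') \<in> {p \<in> X \<times> X. P p} \<and> dist x' x < \<epsilon> \<and> dist y' y < \<epsilon>"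
    using z(1) w(1) by blast
qed auto

lemma dense_crowded_near:
  assumes "chain_proximal X f" "t > 0"
  shows "dense_in (top_of_set (X \<times> X))
    {p \<in> X \<times> X. crowded n {i. dist ((f ^^ i) (fst p)) ((f ^^ i) (snd p)) \<in> {..<t}}}"
proof (rule dense_in_if_shadowed[where \<epsilon>\<^sub>0 = "t / 3" and Q = "\<lambda>xs ys. \<exists>k. \<forall>i\<ge>k. xs i = ys i"])
  fix x y and \<delta> :: real assume "x \<in> X" "y \<in> X" and "\<delta> > 0"
  then obtain k v where reach: "chain_reach X f \<delta> k x v" "chain_reach X f \<delta> k y v"
    using assms(1) unfolding chain_proximal_iff by blast
  obtain xs ys where xy: "pseudo_orbit X f \<delta> xs" "pseudo_orbit X f \<delta> ys" "xs 0 = x" "ys 0 = y"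
      and tail: "\<And>i. xs (k + i) = (f ^^ i) v" "\<And>i. ys (k + i) = (f ^^ i) v"
    using follow_orbits_after_chains[OF reach \<open>\<delta> > 0\<close>] by blast
  have "xs i = ys i" if "i \<ge> k" for i
    using tail[of "i - k"] that by simp
  with xy show "\<exists>xs ys. pseudo_orbit X f \<delta> xs \<and> pseudo_orbit X f \<delta> ys \<and> xs 0 = x \<and> ys 0 = y \<and>
      (\<exists>k. \<forall>i\<ge>k. xs i = ys i)"
    by blast
next
  fix xs ys z w assume "\<exists>k. \<forall>i\<ge>k. xs i = ys i"
    and z: "\<And>i. dist ((f ^^ i) z) (xs i) \<le> t / 3" and w: "\<And>i. dist ((f ^^ i) w) (ys i) \<le> t / 3"
  then obtain k where k: "\<And>i. i \<ge> k \<Longrightarrow> xs i = ys i" by blast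
  have "dist ((f ^^ i) z) ((f ^^ i) w) < t" if "i \<ge> k" for i
    using dist_triangle2[of "(f ^^ i) z" "(f ^^ i) w" "xs i"] z[of i] w[of i] k[OF that] assms(2)
    by simp
  then show "crowded n {i. dist ((f ^^ i) (fst (z, w))) ((f ^^ i) (snd (z, w))) \<in> {..<t}}"
    by (intro crowded_if_eventually[of k]) simp
qed (use assms(2) in simp)

text \<open>Shadowing within \<open>e / 4\<close> costs at most half of the distance \<open>e\<close> of the pseudo orbits. The condition
  is stated with a strict inequality to make it open.\<close>

lemma dense_crowded_far:
  assumes "e > 0"
    and S: "\<And>x y \<delta>. x \<in> X \<Longrightarrow> y \<in> X \<Longrightarrow> \<delta> > 0 \<Longrightarrow> \<exists>xs ys.
      pseudo_orbit X f \<delta> xs \<and> pseudo_orbit X f \<delta> ys \<and> xs 0 = x \<and> ys 0 = y \<and>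
      liminf (\<lambda>i. ereal (dist (xs i) (ys i))) > ereal e"
  shows "dense_in (top_of_set (X \<times> X))
    {p \<in> X \<times> X. crowded n {i. dist ((f ^^ i) (fst p)) ((f ^^ i) (snd p)) \<in> {e / 2<..}}}"
proof (rule dense_in_if_shadowed[where \<epsilon>\<^sub>0 = "e / 4"])
  fix xs ys z w assume lim: "ereal e < liminf (\<lambda>i. ereal (dist (xs i) (ys i)))"
    and z: "\<And>i. dist ((f ^^ i) z) (xs i) \<le> e / 4" and w: "\<And>i. dist ((f ^^ i) w) (ys i) \<le> e / 4"
  obtain k where k: "\<And>i. i \<ge> k \<Longrightarrow> e < dist (xs i) (ys i)"
    using less_LiminfD[OF lim] by (auto simp: eventually_at_top_linorder)
  have "e / 2 < dist ((f ^^ i) z) ((f ^^ i) w)" if "i \<ge> k" for i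
    using dist_triangle3[of "xs i" "ys i" "(f ^^ i) z"] dist_triangle[of "(f ^^ i) z" "ys i" "(f ^^ i) w"]
      k[OF that] z[of i] w[of i] by linarith
  then show "crowded n {i. dist ((f ^^ i) (fst (z, w))) ((f ^^ i) (snd (z, w))) \<in> {e / 2<..}}"
    by (intro crowded_if_eventually[of k]) simp
qed (use assms in auto)

lemma guDC1_if_property_S:
  assumes "property_S X f" "chain_proximal X f"
  shows "guDC1 X f"
proof -
  obtain e where e: "e > 0" "\<And>x y \<delta>. x \<in> X \<Longrightarrow> y \<in> X \<Longrightarrow> \<delta> > 0 \<Longrightarrow> \<exists>xs ys.
      pseudo_orbit X f \<delta> xs \<and> pseudo_orbit X f \<delta> ys \<and> xs 0 = x \<and> ys 0 = y \<and>
      liminf (\<lambda>i. ereal (dist (xs i) (ys i))) > ereal e"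
    using assms(1) unfolding property_S_def by meson
  let ?T = "top_of_set (X \<times> X)"
  let ?d = "\<lambda>p i. dist ((f ^^ i) (fst p)) ((f ^^ i) (snd p))"
  define near where "near = (\<lambda>(j, n). {p \<in> X \<times> X. crowded n {i. ?d p i \<in> {..<inverse (real (Suc j))}}})"
  define far where "far = (\<lambda>n. {p \<in> X \<times> X. crowded n {i. ?d p i \<in> {e / 2<..}}})"
  have residual_near: "residual_in ?T (topspace ?T \<inter> (\<Inter>jn. near jn))"
  proof (rule residual_in_countable_Inter)
    show "openin ?T (near jn)" for jn
      unfolding near_def case_prod_unfold by (rule openin_crowded_distances) simp
    show "dense_in ?T (near jn)" for jn
      unfolding near_def case_prod_unfold by (rule dense_crowded_near[OF assms(2)]) simp
  qed simp
  have residual_far: "residual_in ?T (topspace ?T \<inter> (\<Inter>n. far n))"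
  proof (rule residual_in_countable_Inter)
    show "openin ?T (far n)" for n
      unfolding far_def by (rule openin_crowded_distances) simp
    show "dense_in ?T (far n)" for n
      unfolding far_def by (rule dense_crowded_far[OF e])
  qed simp
  have "residual_in ?T (DC1_delta X f (e / 2))"
  proof (rule residual_in_mono[OF residual_in_Int[OF residual_near residual_far]], rule subsetI)
    fix p assume p: "p \<in> (topspace ?T \<inter> (\<Inter>jn. near jn)) \<inter> (topspace ?T \<inter> (\<Inter>n. far n))"
    obtain x y where xy: "p = (x, y)" by (rule prod.exhaust)
    have mem: "x \<in> X" "y \<in> X" using p by (simp_all add: xy)
    have "crowded n {i. e / 2 \<le> dist ((f ^^ i) x) ((f ^^ i) y)}" for n
    proof -
      have "p \<in> far n" using p by blast
      then have "crowded n {i. ?d p i \<in> {e / 2<..}}" by (simp add: far_def)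
      then show ?thesis by (rule crowded_mono) (auto simp: xy)
    qed
    moreover have "crowded n {i. dist ((f ^^ i) x) ((f ^^ i) y) < t}" if "t > 0" for n t
    proof -
      obtain j where j: "inverse (real (Suc j)) < t" using reals_Archimedean \<open>t > 0\<close> by blast
      have "p \<in> near (j, n)" using p by blast
      then have "crowded n {i. ?d p i \<in> {..<inverse (real (Suc j))}}" by (simp add: near_def)
      then show ?thesis by (rule crowded_mono) (use j in \<open>auto simp: xy\<close>)
    qed
    ultimately show "p \<in> DC1_delta X f (e / 2)"
      using mem by (simp add: xy DC1_delta_iff)
  qed (auto simp: DC1_delta_def)
  then show ?thesis unfolding guDC1_def using e(1) half_gt_zero by blast
qed

text \<open>Every point leads to every point \<open>c\<close> of the core, so that by shadowing the orbit of a generic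
  point accumulates at \<open>c\<close>; then \<open>c\<close> leads to all limit points of this orbit.\<close>

lemma dense_orbits_near_core:
  assumes "c \<in> chain_core" "t > 0"
  shows "dense_in (top_of_set (X \<times> X))
    {p \<in> X \<times> X. (\<exists>i. dist ((f ^^ i) (fst p)) c < t) \<and> (\<exists>i. dist ((f ^^ i) (snd p)) c < t)}"
proof (rule dense_in_if_shadowed[where \<epsilon>\<^sub>0 = "t / 2" and
      Q = "\<lambda>xs ys. (\<exists>i. xs i = c) \<and> (\<exists>i. ys i = c)"])
  fix x y and \<delta> :: real assume xy: "x \<in> X" "y \<in> X" and "\<delta> > 0"
  have "\<exists>zs k. pseudo_orbit X f \<delta> zs \<and> zs 0 = z \<and> zs k = c" if "z \<in> X" for z
  proof -
    have "chain_leads X f z c" "c \<in> X" using assms(1) that by (auto simp: chain_core_def)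
    then obtain k where k: "chain_reach X f \<delta> k z c"
      using \<open>\<delta> > 0\<close> unfolding chain_leads_iff by blast
    have "pseudo_orbit X f \<delta> (\<lambda>i. (f ^^ i) c)"
      using \<open>c \<in> X\<close> \<open>\<delta> > 0\<close> by (intro orbit_pseudo_orbit) auto
    from chain_then_pseudo_orbit[OF k this] obtain zs where
      zs: "pseudo_orbit X f \<delta> zs" "zs 0 = z" "\<And>i. zs (k + i) = (f ^^ i) c" by auto
    from zs(3)[of 0] zs(1,2) show ?thesis by auto
  qed
  from this[OF xy(1)] this[OF xy(2)]
  show "\<exists>xs ys. pseudo_orbit X f \<delta> xs \<and> pseudo_orbit X f \<delta> ys \<and> xs 0 = x \<and> ys 0 = y \<and>
      (\<exists>i. xs i = c) \<and> (\<exists>i. ys i = c)"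
    by blast
next
  fix xs ys z w assume visits: "(\<exists>i. xs i = c) \<and> (\<exists>i. ys i = c)"
    and near: "\<And>i. dist ((f ^^ i) z) (xs i) \<le> t / 2" "\<And>i. dist ((f ^^ i) w) (ys i) \<le> t / 2"
  have "t / 2 < t" using assms(2) by simp
  with visits near
  show "(\<exists>i. dist ((f ^^ i) (fst (z, w))) c < t) \<and> (\<exists>i. dist ((f ^^ i) (snd (z, w))) c < t)"
    unfolding fst_conv snd_conv by (metis le_less_trans)
qed (use assms(2) in simp)

lemma openin_orbits_near:
  "openin (top_of_set (X \<times> X))
    {p \<in> X \<times> X. (\<exists>i. dist ((f ^^ i) (fst p)) c < t) \<and> (\<exists>i. dist ((f ^^ i) (snd p)) c < t)}"
proof -
  have "openin (top_of_set X) (X \<inter> (f ^^ i) -` ball c t)" for i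
    by (rule continuous_openin_preimage_gen[OF iterate_cont open_ball])
  then have "openin (top_of_set X) (\<Union>i. X \<inter> (f ^^ i) -` ball c t)" by (intro openin_Union) auto
  from openin_Times[OF this this] show ?thesis
    by (rule back_subst[where P = "openin _"]) (auto simp: dist_commute)
qed

lemma distal_pair_in_core_if_gDC1:
  assumes "gDC1 X f" "c \<in> chain_core"
  shows "\<exists>p\<in>chain_core. \<exists>q\<in>chain_core. distal_pair f p q"
proof -
  let ?T = "top_of_set (X \<times> X)"
  have "c \<in> X" using assms(2) by (simp add: chain_core_def)
  define U where "U n = {p \<in> X \<times> X. (\<exists>i. dist ((f ^^ i) (fst p)) c < inverse (real (Suc n))) \<and>
    (\<exists>i. dist ((f ^^ i) (snd p)) c < inverse (real (Suc n)))}" for n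
  have "residual_in ?T (topspace ?T \<inter> (\<Inter>n. U n))"
    unfolding U_def using openin_orbits_near dense_orbits_near_core[OF assms(2)]
    by (intro residual_in_countable_Inter) auto
  with assms(1) have "residual_in ?T (DC1 X f \<inter> (topspace ?T \<inter> (\<Inter>n. U n)))"
    unfolding gDC1_def by (rule residual_in_Int)
  then have "dense_in ?T (DC1 X f \<inter> (topspace ?T \<inter> (\<Inter>n. U n)))"
    by (rule residual_in_imp_dense_in[OF compact_Times[OF compact_X compact_X]])
  then obtain x y where xy: "(x, y) \<in> DC1 X f" "\<And>n. (x, y) \<in> U n"
    using \<open>c \<in> X\<close> unfolding dense_in_Times_iff by (metis IntE INT_E UNIV_I zero_less_one)
  then obtain \<delta> where \<delta>: "\<delta> > 0" "(x, y) \<in> DC1_delta X f \<delta>" unfolding DC1_def by auto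
  then have mem: "x \<in> X" "y \<in> X" and "\<And>n. crowded n {i. \<delta> \<le> dist ((f ^^ i) x) ((f ^^ i) y)}"
    by (auto simp: DC1_delta_iff)
  then obtain p q m where pq: "p \<in> X" "q \<in> X" "\<And>i. \<delta> \<le> dist ((f ^^ i) p) ((f ^^ i) q)"
      and m: "\<And>n. n \<le> m n" and lim: "(\<lambda>n. (f ^^ m n) x) \<longlonglongrightarrow> p" "(\<lambda>n. (f ^^ m n) y) \<longlonglongrightarrow> q"
    using distal_limit_pair[OF mem] by blast
  have core: "a \<in> chain_core" if "z \<in> X" "a \<in> X" "(\<lambda>n. (f ^^ m n) z) \<longlonglongrightarrow> a"
    and visits: "\<And>n. \<exists>i. dist ((f ^^ i) z) c < inverse (real (Suc n))" for z a
  proof (rule chain_core_leads_mem[OF assms(2) \<open>a \<in> X\<close>], unfold chain_leads_iff, intro allI impI)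
    fix \<eta> :: real assume "\<eta> > 0"
    then obtain d where d: "d > 0" "\<forall>x\<in>X. dist x c < d \<longrightarrow> dist (f x) (f c) < \<eta> / 2"
      using continuity_at[OF \<open>c \<in> X\<close>, of "\<eta> / 2"] by auto
    obtain n where "inverse (real (Suc n)) < d" using reals_Archimedean d(1) by blast
    then obtain i where "dist ((f ^^ i) z) c < d" using visits[of n] by (meson less_trans)
    then have start: "dist (f c) (f ((f ^^ i) z)) \<le> \<eta> / 2"
      using d(2) iterate_mem[OF \<open>z \<in> X\<close>] by (metis dist_commute less_imp_le)
    have "\<forall>\<^sub>F n in sequentially. dist ((f ^^ m n) z) a < \<eta> / 2 \<and> n > i"
      using \<open>\<eta> > 0\<close> by (intro eventually_conj tendstoD that(3) eventually_gt_at_top) auto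
    then obtain n where n: "dist ((f ^^ m n) z) a < \<eta> / 2" "n > i"
      using eventually_happens' sequentially_bot by blast
    have "i < m n" using n(2) m[of n] by linarith
    from chain_reach_via_orbit_segment[OF \<open>c \<in> X\<close> \<open>z \<in> X\<close> \<open>a \<in> X\<close> this start less_imp_le[OF n(1)]]
    show "\<exists>k. chain_reach X f \<eta> k c a" by blast
  qed
  have "p \<in> chain_core" "q \<in> chain_core"
    using core mem pq lim xy(2) by (auto simp: U_def)
  moreover have "distal_pair f p q" using \<delta>(1) pq(3) unfolding distal_pair_iff by blast
  ultimately show ?thesis by blast
qed

end

theorem theorem1p2:
  fixes X :: "'a::metric_space set" and f :: "'a \<Rightarrow> 'a"
  assumes "compact X" and "X \<noteq> {}"
    and "f ` X \<subseteq> X" and "continuous_on X f"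
    and "shadowing_property X f"
  shows "(property_S X f \<and> chain_proximal X f \<longleftrightarrow>
            chain_proximal X f \<and>
            (\<exists>C. {D \<in> chain_components X f. chain_stable X f D} = {C} \<and>
                 (\<exists>x\<in>C. \<exists>y\<in>C. distal_pair f x y))) \<and>
         (property_S X f \<and> chain_proximal X f \<longleftrightarrow> guDC1 X f) \<and>
         (property_S X f \<and> chain_proximal X f \<longleftrightarrow> duDC1 X f) \<and>
         (property_S X f \<and> chain_proximal X f \<longleftrightarrow> gDC1 X f)"
proof -
  interpret shadowing_system X f
    using assms by unfold_locales
  let ?T = "top_of_set (X \<times> X)"
  let ?one = "property_S X f \<and> chain_proximal X f"
  let ?two = "chain_proximal X f \<and> (\<exists>x\<in>chain_core. \<exists>y\<in>chain_core. distal_pair f x y)"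
  have residual_dense: "residual_in ?T D \<Longrightarrow> dense_in ?T D" for D
    by (rule residual_in_imp_dense_in[OF compact_Times[OF compact_X compact_X]])
  have DC1: "DC1_delta X f \<delta> \<subseteq> DC1 X f" "DC1 X f \<subseteq> topspace ?T" if "\<delta> > 0" for \<delta>
    using that by (auto simp: DC1_def DC1_delta_def)
  have core: "chain_core \<noteq> {}" if "chain_proximal X f"
    using chain_core_nonempty that assms(2) by blast
  have two_iff: "?two \<longleftrightarrow> chain_proximal X f \<and>
      (\<exists>C. {D \<in> chain_components X f. chain_stable X f D} = {C} \<and> (\<exists>x\<in>C. \<exists>y\<in>C. distal_pair f x y))"
    by (cases "chain_proximal X f") (simp_all add: chain_stable_components[OF _ assms(2)])
  have one_two: ?two if ?one
    using that distal_pair_in_core_if_property_S core by blast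
  have two_one: ?one if ?two
    using that property_S_if_distal_pair_in_core by blast
  have one_gu: "guDC1 X f" if ?one
    using that guDC1_if_property_S by blast
  have gu_du: "duDC1 X f" if "guDC1 X f"
    using that residual_dense unfolding guDC1_def duDC1_def by blast
  have gu_g: "gDC1 X f" if "guDC1 X f"
    using that residual_in_mono DC1 unfolding guDC1_def gDC1_def by metis
  have du_one: ?one if du: "duDC1 X f"
  proof
    obtain \<delta> where \<delta>: "\<delta> > 0" "dense_in ?T (DC1_delta X f \<delta>)"
      using du unfolding duDC1_def by blast
    then have "dense_in ?T (DC1 X f)"
      using DC1[OF \<delta>(1)] unfolding dense_in_Times_iff by (simp add: subset_eq) meson
    then show "chain_proximal X f" by (rule chain_proximal_if_dense_DC1)
  qed (rule property_S_if_duDC1[OF du])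
  have g_two: ?two if "gDC1 X f"
  proof -
    have "chain_proximal X f"
      using that residual_dense chain_proximal_if_dense_DC1 unfolding gDC1_def by blast
    with core distal_pair_in_core_if_gDC1[OF that] show ?thesis by blast
  qed
  show ?thesis
    using two_iff one_two two_one one_gu gu_du gu_g du_one g_two by argo
qed

end
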